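(* Let $p$ and $q$ be distinct primes with $\gcd(p-1,q-1)=4$, and let $g,h,e$, the classes $D_0,\dots,D_3$, the polynomials $D_k(X)$, the quaternary sequence $(e_u)$ over $\mathbb{Z}_4$ and the (generalized) trace functions be as defined in the context. Let $\ell$ be the multiplicative order of $2$ modulo $pq$ and $\ell_p$ the multiplicative order of $2$ modulo $p$. Let $\beta\in GR(4,4^{\ell})$ be a primitive $pq$-th root of unity and let $\rho=D_1(\beta)+2D_2(\beta)+3D_3(\beta)$. If $p\equiv 5\pmod 8$ and $q\equiv 5\pmod 8$, then for all $u\ge 0$ $$e_u=2+2\sum_{i=0}^{\frac{p-1}{\ell_p}-1}\mathrm{TR}_1^{\ell_p}\left(\beta^{ug^iq}\right)+\sum_{j=0}^{3}(\rho-j)\sum_{i=0}^{\frac{e}{\ell}-1}\mathrm{TR}_1^{\ell}\left(\beta^{ug^ih^j}\right)$$ if $2\in D_0$, and $$e_u=2+2\sum_{i=0}^{\frac{p-1}{\ell_p}-1}\mathrm{TR}_1^{\ell_p}\left(\beta^{ug^iq}\right)+\sum_{j=0}^{3}(\rho-j)\sum_{i=0}^{\frac{2e}{\ell}-1}\mathrm{TR}_2^{\ell}\left(\beta^{ug^ih^j}\right)$$ if $2\in D_2$.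
   Context: $\mathbb{Z}_m=\{0,1,\dots,m-1\}$ is the residue class ring modulo $m$. $p,q$ are distinct primes with $\gcd(p-1,q-1)=4$, and $e=(p-1)(q-1)/4$. Fix an integer $g$ that is a common primitive root of both $p$ and $q$, and an integer $h$ with $h\equiv g\pmod p$, $h\equiv 1\pmod q$. The generalized cyclotomic classes of order $4$ modulo $pq$ are $D_i=\{g^sh^i \bmod pq: s=0,1,\dots,e-1\}\subseteq\{0,\dots,pq-1\}$ for $0\le i<4$; they partition $\mathbb{Z}_{pq}^*$. Put $D_i(X)=\sum_{u\in D_i}X^u\in\mathbb{Z}_4[X]$. Let $P=\{p,2p,\dots,(q-1)p\}$, $Q=\{q,2q,\dots,(p-1)q\}$, $R=\{0\}$. The sequence $(e_u)_{u\ge 0}$ over $\mathbb{Z}_4$ of period $pq$ is: $e_u=2$ if $u\bmod pq\in Q\cup R$; $e_u=0$ if $u\bmod pq\in P$; $e_u=i$ if $u\bmod pq\in D_i$, $i=0,1,2,3$. $GR(4,4^r)$ is the Galois ring $\mathbb{Z}_4[X]/(f(X))$ of characteristic $4$ with $4^r$ elements, where $f$ has degree $r$ and is irreducible modulo $2$; for $s\mid r$, $GR(4,4^s)$ is regarded as a subring of $GR(4,4^r)$. A primitive $pq$-th root of unity is a unit of multiplicative order exactly $pq$. The Teichmuller set of $GR(4,4^r)$ is $\mathcal{T}=\{0,1,\xi,\dots,\xi^{2^r-2}\}$, where $\xi$ is a unit of order $2^r-1$; every element of $GR(4,4^r)$ is uniquely $\alpha_1+2\alpha_2$ with $\alpha_1,\alpha_2\in\mathcal{T}$.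 For $s\mid r$, the generalized Frobenius automorphism of $GR(4,4^r)$ over $GR(4,4^s)$ is $\Phi_s(\alpha_1+2\alpha_2)=\alpha_1^{2^s}+2\alpha_2^{2^s}$ ($\alpha_1,\alpha_2\in\mathcal{T}$), and the generalized trace function $\mathrm{TR}_s^r:GR(4,4^r)\to GR(4,4^s)$ is $\mathrm{TR}_s^r(\alpha)=\sum_{k=0}^{r/s-1}\Phi_s^k(\alpha)$. (For $s=1$ this is the trace function to $\mathbb{Z}_4$. In particular, $\mathrm{TR}_s^r(\alpha_1)=\alpha_1+\alpha_1^{2^s}+\dots+\alpha_1^{2^{s(r/s-1)}}$ for $\alpha_1\in\mathcal{T}$.) The powers of $\beta^q$ lie in $GR(4,4^{\ell_p})$. *)

theory Defs
  imports
    "HOL-Algebra.UnivPoly"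
    "HOL-Algebra.QuotRing"
    "HOL-Algebra.Ring_Divisibility"
    "HOL-Algebra.Subrings"
    "HOL-Number_Theory.Number_Theory"
begin

section \<open>Galois rings of characteristic 4\<close>

text \<open>
  The condition on the coefficient of $X^r$ says that the leading coefficient is a unit, i.e. that
  \<open>f\<close> still has degree \<open>r\<close> after reduction modulo 2. Without it the quotient of $\mathbb{Z}_4[X]$
  by \<open>(f)\<close> need not have $4^r$ elements.
\<close>

definition basic_irreducible :: "nat \<Rightarrow> (nat \<Rightarrow> int) \<Rightarrow> bool" where
  "basic_irreducible r f \<longleftrightarrow>
     f \<in> carrier (UP (residue_ring 4)) \<and>
     deg (residue_ring 4) f = r \<and>
     coeff (UP (residue_ring 4)) f r \<in> Units (residue_ring 4) \<and>
     ring_irreducible\<^bsub>UP (residue_ring 2)\<^esub> (\<lambda>n. coeff (UP (residue_ring 4)) f n mod 2)"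

text \<open>
  \<open>galois_ring4 r R\<close>: the ring \<open>R\<close> is a copy of $GR(4,4^r)$. Stating this up to isomorphism
  allows a subring of a bigger Galois ring to be a $GR(4,4^s)$.
\<close>

definition galois_ring4 :: "nat \<Rightarrow> ('a, 'm) ring_scheme \<Rightarrow> bool" where
  "galois_ring4 r R \<longleftrightarrow>
     ring R \<and>
     (\<exists>f. basic_irreducible r f \<and>
          R \<simeq> UP (residue_ring 4) Quot (PIdl\<^bsub>UP (residue_ring 4)\<^esub> f))"

text \<open>The canonical map from $\mathbb{Z}_4$ (and from the integers) to a ring of characteristic 4.\<close>

definition of_Z4 :: "('a, 'm) ring_scheme \<Rightarrow> int \<Rightarrow> 'a" where
  "of_Z4 R k = [k] \<cdot>\<^bsub>R\<^esub> \<one>\<^bsub>R\<^esub>"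

definition unit_of_order :: "('a, 'm) ring_scheme \<Rightarrow> nat \<Rightarrow> 'a \<Rightarrow> bool" where
  "unit_of_order R n x \<longleftrightarrow> x \<in> Units R \<and> group.ord (units_of R) x = n"

text \<open>In $GR(4,4^r)$ the resulting set does not depend on the choice of the generator.\<close>

definition teichmuller :: "('a, 'm) ring_scheme \<Rightarrow> nat \<Rightarrow> 'a set" where
  "teichmuller R r =
     (let \<xi> = (SOME x. unit_of_order R (2 ^ r - 1) x)
      in insert \<zero>\<^bsub>R\<^esub> {\<xi> [^]\<^bsub>R\<^esub> k |k::nat. k < 2 ^ r - 1})"

text \<open>
  \<open>gr_frobenius R r s\<close> and \<open>gr_trace R s r\<close> are $\Phi_s$ and $\mathrm{TR}_s^r$ on a
  copy \<open>R\<close> of $GR(4,4^r)$, where \<open>s\<close> divides \<open>r\<close>.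
\<close>

definition gr_frobenius :: "('a, 'm) ring_scheme \<Rightarrow> nat \<Rightarrow> nat \<Rightarrow> 'a \<Rightarrow> 'a" where
  "gr_frobenius R r s x =
     (let (a, b) = (THE (a, b). a \<in> teichmuller R r \<and> b \<in> teichmuller R r \<and>
                                x = a \<oplus>\<^bsub>R\<^esub> of_Z4 R 2 \<otimes>\<^bsub>R\<^esub> b)
      in a [^]\<^bsub>R\<^esub> (2 ^ s :: nat) \<oplus>\<^bsub>R\<^esub> of_Z4 R 2 \<otimes>\<^bsub>R\<^esub> b [^]\<^bsub>R\<^esub> (2 ^ s :: nat))"

definition gr_trace :: "('a, 'm) ring_scheme \<Rightarrow> nat \<Rightarrow> nat \<Rightarrow> 'a \<Rightarrow> 'a" where
  "gr_trace R s r x = (\<Oplus>\<^bsub>R\<^esub>k\<in>{..<r div s}. (gr_frobenius R r s ^^ k) x)"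


section \<open>Generalized cyclotomic classes and the quaternary sequence\<close>

definition primitive_root :: "nat \<Rightarrow> int \<Rightarrow> bool" where
  "primitive_root n g \<longleftrightarrow> residue_primroot n (nat (g mod int n))"

definition cyc_class :: "nat \<Rightarrow> nat \<Rightarrow> int \<Rightarrow> int \<Rightarrow> nat \<Rightarrow> nat set" where
  "cyc_class p q g h i =
     {nat ((g ^ s * h ^ i) mod int (p * q)) |s::nat. s < (p - 1) * (q - 1) div 4}"

definition class_poly :: "nat \<Rightarrow> nat \<Rightarrow> int \<Rightarrow> int \<Rightarrow> nat \<Rightarrow> nat \<Rightarrow> int" where
  "class_poly p q g h i =
     (\<Oplus>\<^bsub>UP (residue_ring 4)\<^esub>u\<in>cyc_class p q g h i. monom (UP (residue_ring 4)) 1 u)"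

definition eval_Z4 :: "('a, 'm) ring_scheme \<Rightarrow> (nat \<Rightarrow> int) \<Rightarrow> 'a \<Rightarrow> 'a" where
  "eval_Z4 R f x = UnivPoly.eval (residue_ring 4) R (of_Z4 R) x f"

text \<open>The sequence over $\mathbb{Z}_4$, with values in the carrier \<open>{0..3}\<close> of \<open>residue_ring 4\<close>.\<close>

definition quat_seq :: "nat \<Rightarrow> nat \<Rightarrow> int \<Rightarrow> int \<Rightarrow> nat \<Rightarrow> int" where
  "quat_seq p q g h u =
     (let v = u mod (p * q);
          P = {k * p |k. k \<in> {1..q - 1}};
          Q = {k * q |k. k \<in> {1..p - 1}};
          R = {0}
      in if v \<in> Q \<union> R then 2
         else if v \<in> P then 0
         else int (THE i. i < 4 \<and> v \<in> cyc_class p q g h i))"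

end

theory Submission
  imports Defs
begin

text \<open>
  Both sides are evaluated separately on the four types of \<open>u\<close>: multiples of \<open>p\<close> only, of \<open>q\<close>
  only, of both, and units modulo \<open>pq\<close>. Since 2 (respectively 4) lies in $D_0 = \langle g\rangle$,
  the inner sums of traces run over the cosets of $\langle 2\rangle$ (respectively
  $\langle 4\rangle$) in $\langle g\rangle$ and collapse to $D_j(\beta^u)$; this uses that a trace
  of a root of unity of odd order is the plain sum of its Frobenius conjugates $x^{2^{sk}}$.
  For \<open>u\<close> in $D_i$ one has $D_j(\beta^u) = D_{i+j}(\beta)$, with indices modulo 4, and
  $\sum_j D_j(\beta) = 1$, so that
  $\sum_j (\rho - j) D_{i+j}(\beta) = \rho - \sum_j (j - i) D_j(\beta) = i$. For a non-unit \<open>u\<close> the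
  value $D_j(\beta^u)$ is an integer not depending on \<open>j\<close>, equal to $-(p-1)/4$ or $-(q-1)/4$ (odd
  because $p \equiv q \equiv 5$ modulo 8) or to $e \equiv 0$ modulo 4.

  Everything needed about a Galois ring follows from its reduction modulo 2 onto a field with
  $2^r$ elements: the kernel is generated by 2, and $4 = 0$ makes squaring constant on its cosets,
  so elements of the same odd order with the same reduction are equal.
\<close>

text \<open>A Galois ring has zero divisors, so neither the bound on the number of roots of X^m - 1
  nor the vanishing of 1 + x + ... + x^(n-1) for an n-th root of unity x other than 1 is directly
  available. Both are recovered from the residue field: an element with nonzero reduction is a unit,
  and x - 1 is such an element if n is odd.

  The constants of the formula are explained modulo 4. The sum of traces attached to p is 0 if p
  divides u and -1 otherwise, and a common value c of the D_j(beta^u) contributes sum_j (rho - j) c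
  = 2c. So the right-hand side is 2 + 0 + 0 if pq divides u, 2 - 2 + 2 if only q does, 2 + 0 + 2 if
  only p does, and 2 - 2 + i on D_i; rho is the normalisation that makes the last sum vanish on D_0.

  If 2 lies in D_2, squaring exchanges the classes j and j + 2, and only 4 is a power of g modulo
  pq. This is why the trace then goes down to GR(4,4^2) and has l/2 summands.\<close>

section \<open>Polynomials over a field and Galois rings\<close>

text \<open>Pseudo-division only divides a multiple of \<open>f\<close> by a power of the leading
  coefficient of \<open>g\<close>; when that coefficient is a unit, the power can be divided away
  again.\<close>

lemma (in UP_cring) unit_lcoeff_division:
  assumes f: "f \<in> carrier P" and g: "g \<in> carrier P"
    and unit: "coeff P g (deg R g) \<in> Units R" and nz: "g \<noteq> \<zero>\<^bsub>P\<^esub>"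
  shows "\<exists>q r. q \<in> carrier P \<and> r \<in> carrier P \<and> f = g \<otimes>\<^bsub>P\<^esub> q \<oplus>\<^bsub>P\<^esub> r \<and>
    (r = \<zero>\<^bsub>P\<^esub> \<or> deg R r < deg R g)"
proof -
  let ?u = "coeff P g (deg R g)"
  obtain q r and k :: nat where q: "q \<in> carrier P" and r: "r \<in> carrier P"
    and eq: "?u [^] k \<odot>\<^bsub>P\<^esub> f = g \<otimes>\<^bsub>P\<^esub> q \<oplus>\<^bsub>P\<^esub> r" and d: "r = \<zero>\<^bsub>P\<^esub> \<or> deg R r < deg R g"
    using long_div_theorem[OF g f nz] by blast
  have uk: "?u [^] k \<in> Units R" using unit by (rule R.Units_pow_closed)
  define v where "v = inv (?u [^] k)"
  have v: "v \<in> carrier R" "v \<otimes> ?u [^] k = \<one>" using uk by (auto simp: v_def)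
  have "f = v \<odot>\<^bsub>P\<^esub> (?u [^] k \<odot>\<^bsub>P\<^esub> f)"
    using v uk f smult_assoc1[of v "?u [^] k" f] smult_one by (metis R.Units_closed)
  also have "\<dots> = v \<odot>\<^bsub>P\<^esub> (g \<otimes>\<^bsub>P\<^esub> q) \<oplus>\<^bsub>P\<^esub> v \<odot>\<^bsub>P\<^esub> r"
    unfolding eq using v q r g by (simp add: smult_r_distr)
  also have "v \<odot>\<^bsub>P\<^esub> (g \<otimes>\<^bsub>P\<^esub> q) = g \<otimes>\<^bsub>P\<^esub> (v \<odot>\<^bsub>P\<^esub> q)"
    using smult_assoc2[OF v(1) q g] P.m_comm[OF g q] P.m_comm[OF g, of "v \<odot>\<^bsub>P\<^esub> q"] v q by simp
  finally have "f = g \<otimes>\<^bsub>P\<^esub> (v \<odot>\<^bsub>P\<^esub> q) \<oplus>\<^bsub>P\<^esub> v \<odot>\<^bsub>P\<^esub> r" .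
  moreover have "v \<odot>\<^bsub>P\<^esub> r = \<zero>\<^bsub>P\<^esub> \<or> deg R (v \<odot>\<^bsub>P\<^esub> r) < deg R g"
    using d
  proof
    assume "r = \<zero>\<^bsub>P\<^esub>"
    with v(1) show ?thesis by simp
  next
    assume "deg R r < deg R g"
    with deg_smult_decr[OF v(1) r] show ?thesis by linarith
  qed
  moreover have "v \<odot>\<^bsub>P\<^esub> q \<in> carrier P" "v \<odot>\<^bsub>P\<^esub> r \<in> carrier P" using v(1) q r by simp_all
  ultimately show ?thesis by (intro exI conjI)
qed

lemma UP_field_euclidean_domain:
  assumes "field K"
  shows "euclidean_domain (UP K) (deg K)"
proof -
  interpret K: field K by fact
  interpret UP_domain K "UP K" by unfold_locales
  show ?thesis
  proof (rule euclidean_domainI)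
    fix a b assume ab: "a \<in> carrier (UP K) - {\<zero>\<^bsub>UP K\<^esub>}" "b \<in> carrier (UP K) - {\<zero>\<^bsub>UP K\<^esub>}"
    then have "coeff (UP K) b (deg K b) \<in> Units K"
      using lcoeff_nonzero[of b] K.field_Units by auto
    then show "\<exists>q r. q \<in> carrier (UP K) \<and> r \<in> carrier (UP K) \<and>
      a = b \<otimes>\<^bsub>UP K\<^esub> q \<oplus>\<^bsub>UP K\<^esub> r \<and> (r = \<zero>\<^bsub>UP K\<^esub> \<or> deg K r < deg K b)"
      using ab unit_lcoeff_division[of a b] by blast
  qed
qed

lemma UP_Quot_irreducible_field:
  assumes K: "field K" and f: "f \<in> carrier (UP K)" "ring_irreducible\<^bsub>UP K\<^esub> f"
  shows "field (UP K Quot (PIdl\<^bsub>UP K\<^esub> f))"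
proof -
  interpret euclidean_domain "UP K" "deg K" by (rule UP_field_euclidean_domain[OF K])
  show ?thesis
    using maximalideal.quotient_is_field[OF irreducible_imp_maximalideal[OF f] is_cring] .
qed

text \<open>Division with remainder picks one polynomial of degree below \<open>deg K f\<close> in
  each coset, so the quotient is counted by coefficient vectors.\<close>

lemma bij_betw_UP_Quot:
  assumes K: "field K" and f: "f \<in> carrier (UP K)" "f \<noteq> \<zero>\<^bsub>UP K\<^esub>"
  shows "bij_betw (\<lambda>c. (PIdl\<^bsub>UP K\<^esub> f) +>\<^bsub>UP K\<^esub> (\<lambda>n. if n < deg K f then c n else \<zero>\<^bsub>K\<^esub>))
    (PiE {..<deg K f} (\<lambda>_. carrier K)) (carrier (UP K Quot (PIdl\<^bsub>UP K\<^esub> f)))"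
proof -
  interpret K: field K by fact
  interpret UP_domain K "UP K" by unfold_locales
  let ?P = "UP K" and ?r = "deg K f"
  let ?I = "PIdl\<^bsub>?P\<^esub> f"
  \<comment> \<open>Members of \<open>PiE\<close> are \<open>undefined\<close> beyond the index
    range; padding with zeros turns them into polynomials.\<close>
  let ?z = "\<lambda>c n. if n < ?r then c n else \<zero>\<^bsub>K\<^esub>"
  interpret I: ideal ?I ?P using P.cgenideal_ideal[OF f(1)] .
  have z: "?z c \<in> carrier ?P" if "c \<in> PiE {..<?r} (\<lambda>_. carrier K)" for c
  proof -
    have "bound \<zero>\<^bsub>K\<^esub> ?r (?z c)" by (rule bound.intro) simp
    moreover have "?z c n \<in> carrier K" for n using that by (auto simp: PiE_iff)
    ultimately have "?z c \<in> up K" by (intro mem_upI exI[of _ ?r])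
    then show ?thesis by (simp add: UP_def)
  qed
  have coeff: "coeff ?P (?z c) n = ?z c n" if "c \<in> PiE {..<?r} (\<lambda>_. carrier K)" for c n
    using z[OF that] by (simp add: UP_def)
  show ?thesis
  proof (intro bij_betw_imageI inj_onI equalityI subsetI)
    fix c d assume c: "c \<in> PiE {..<?r} (\<lambda>_. carrier K)" and d: "d \<in> PiE {..<?r} (\<lambda>_. carrier K)"
      and eq: "?I +>\<^bsub>?P\<^esub> ?z c = ?I +>\<^bsub>?P\<^esub> ?z d"
    have "?z c \<ominus>\<^bsub>?P\<^esub> ?z d \<in> ?I"
      using eq P.quotient_eq_iff_same_a_r_cos[OF I.ideal_axioms z[OF c] z[OF d]] by simp
    then obtain h where h: "h \<in> carrier ?P" "?z c \<ominus>\<^bsub>?P\<^esub> ?z d = h \<otimes>\<^bsub>?P\<^esub> f"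
      unfolding cgenideal_def by auto
    have co: "coeff ?P (?z c \<ominus>\<^bsub>?P\<^esub> ?z d) n = ?z c n \<ominus>\<^bsub>K\<^esub> ?z d n" for n
      using z[OF c] z[OF d] by (simp add: coeff_minus coeff[OF c] coeff[OF d])
    have zero: "?z c \<ominus>\<^bsub>?P\<^esub> ?z d = \<zero>\<^bsub>?P\<^esub>"
    \<comment> \<open>A nonzero multiple of \<open>f\<close> has degree at least \<open>?r\<close>,
      but all coefficients of this difference from \<open>?r\<close> on are zero.\<close>
    proof (rule ccontr)
      assume nz: "?z c \<ominus>\<^bsub>?P\<^esub> ?z d \<noteq> \<zero>\<^bsub>?P\<^esub>"
      then have "h \<noteq> \<zero>\<^bsub>?P\<^esub>" using h f by auto
      then have "deg K (?z c \<ominus>\<^bsub>?P\<^esub> ?z d) = deg K h + ?r"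
        using h f by (simp add: deg_mult)
      moreover have "coeff ?P (?z c \<ominus>\<^bsub>?P\<^esub> ?z d) (deg K (?z c \<ominus>\<^bsub>?P\<^esub> ?z d)) \<noteq> \<zero>\<^bsub>K\<^esub>"
        using nz z[OF c] z[OF d] by (intro lcoeff_nonzero) auto
      ultimately show False unfolding co by (simp add: K.r_right_minus_eq)
    qed
    then have "?z c = ?z d" using z[OF c] z[OF d] by (simp add: P.r_right_minus_eq)
    then have "c n = d n" if "n < ?r" for n using that by (metis (mono_tags, lifting))
    then show "c = d" using c d by (intro PiE_ext[of c _ _ d]) auto
  next
    fix X assume "X \<in> (\<lambda>c. ?I +>\<^bsub>?P\<^esub> ?z c) ` PiE {..<?r} (\<lambda>_. carrier K)"
    then show "X \<in> carrier (?P Quot ?I)"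
      using z by (auto simp: FactRing_def A_RCOSETS_def' )
  next
    fix X assume "X \<in> carrier (?P Quot ?I)"
    then obtain a where a: "a \<in> carrier ?P" and X: "X = ?I +>\<^bsub>?P\<^esub> a"
      by (auto simp: FactRing_def A_RCOSETS_def')
    have "coeff ?P f ?r \<in> Units K" using lcoeff_nonzero[OF f(2,1)] K.field_Units f by auto
    then obtain q r where q: "q \<in> carrier ?P" and r: "r \<in> carrier ?P"
      and eq: "a = f \<otimes>\<^bsub>?P\<^esub> q \<oplus>\<^bsub>?P\<^esub> r" and dr: "r = \<zero>\<^bsub>?P\<^esub> \<or> deg K r < ?r"
      using unit_lcoeff_division[OF a f(1) _ f(2)] by blast
    have r0: "coeff ?P r n = \<zero>\<^bsub>K\<^esub>" if "\<not> n < ?r" for n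
      using dr that r deg_aboveD[of r n] by auto
    define c where "c = restrict (coeff ?P r) {..<?r}"
    have c: "c \<in> PiE {..<?r} (\<lambda>_. carrier K)" using r by (auto simp: c_def)
    have "?z c = r"
      by (rule up_eqI) (use r0 r z[OF c] in \<open>auto simp: coeff[OF c] c_def\<close>)
    moreover have "a \<ominus>\<^bsub>?P\<^esub> r = q \<otimes>\<^bsub>?P\<^esub> f"
      unfolding eq using q r f(1) by (simp add: P.m_comm P.minus_eq P.a_assoc P.r_neg)
    then have "a \<ominus>\<^bsub>?P\<^esub> r \<in> ?I" using q unfolding cgenideal_def by auto
    then have "X = ?I +>\<^bsub>?P\<^esub> r"
      using P.quotient_eq_iff_same_a_r_cos[OF I.ideal_axioms a r] X by simp
    ultimately show "X \<in> (\<lambda>c. ?I +>\<^bsub>?P\<^esub> ?z c) ` PiE {..<?r} (\<lambda>_. carrier K)" using c by blast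
  qed
qed

lemma
  assumes K: "field K" "finite (carrier K)" and f: "f \<in> carrier (UP K)" "f \<noteq> \<zero>\<^bsub>UP K\<^esub>"
  shows finite_UP_Quot: "finite (carrier (UP K Quot (PIdl\<^bsub>UP K\<^esub> f)))"
    and card_UP_Quot: "card (carrier (UP K Quot (PIdl\<^bsub>UP K\<^esub> f))) = card (carrier K) ^ deg K f"
proof -
  note b = bij_betw_UP_Quot[OF K(1) f]
  show "finite (carrier (UP K Quot (PIdl\<^bsub>UP K\<^esub> f)))"
    using bij_betw_finite[OF b] K(2) finite_PiE[of "{..<deg K f}" "\<lambda>_. carrier K"] by simp
  show "card (carrier (UP K Quot (PIdl\<^bsub>UP K\<^esub> f))) = card (carrier K) ^ deg K f"
    using bij_betw_same_card[OF b] by (simp add: card_PiE)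
qed

text \<open>Applied to k mod 2, this provides the coefficientwise reduction from Z_4[X] to
  Z_2[X].\<close>

lemma UP_map_ring_hom:
  assumes A: "cring A" and B: "cring B" and h: "h \<in> ring_hom A B"
  shows "(\<lambda>a n. h (coeff (UP A) a n)) \<in> ring_hom (UP A) (UP B)"
proof -
  interpret ring_hom_cring A B h
    using A B h by (simp add: ring_hom_cring_def ring_hom_cring_axioms_def)
  interpret A: UP_cring A "UP A" by unfold_locales
  interpret B: UP_cring B "UP B" by unfold_locales
  let ?m = "\<lambda>a n. h (coeff (UP A) a n)"
  have m: "?m a \<in> carrier (UP B)" if "a \<in> carrier (UP A)" for a
  proof -
    have "h (coeff (UP A) a n) = \<zero>\<^bsub>B\<^esub>" if "deg A a < n" for n
      using A.deg_aboveD[OF that \<open>a \<in> carrier (UP A)\<close>] by simp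
    then have "?m a \<in> up B"
      using that by (intro mem_upI exI[of _ "deg A a"]) auto
    then show ?thesis by (simp add: UP_def)
  qed
  have co: "coeff (UP B) (?m a) n = h (coeff (UP A) a n)" if "a \<in> carrier (UP A)" for a n
    using m[OF that] by (simp add: UP_def)
  show ?thesis
  proof (rule ring_hom_memI)
    fix a b assume ab: "a \<in> carrier (UP A)" "b \<in> carrier (UP A)"
    show "?m (a \<otimes>\<^bsub>UP A\<^esub> b) = ?m a \<otimes>\<^bsub>UP B\<^esub> ?m b"
    proof (rule B.up_eqI)
      fix n
      show "coeff (UP B) (?m (a \<otimes>\<^bsub>UP A\<^esub> b)) n = coeff (UP B) (?m a \<otimes>\<^bsub>UP B\<^esub> ?m b) n"
        unfolding B.coeff_mult[OF m m, OF ab]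
        by (rule trans[OF co[OF A.UP_mult_closed[OF ab]]]) (use ab in \<open>simp add: co Pi_def o_def\<close>)
    qed (rule m[OF A.UP_mult_closed[OF ab]] B.UP_mult_closed[OF m m, OF ab])+
    show "?m (a \<oplus>\<^bsub>UP A\<^esub> b) = ?m a \<oplus>\<^bsub>UP B\<^esub> ?m b"
    proof (rule B.up_eqI)
      fix n
      show "coeff (UP B) (?m (a \<oplus>\<^bsub>UP A\<^esub> b)) n = coeff (UP B) (?m a \<oplus>\<^bsub>UP B\<^esub> ?m b) n"
        unfolding B.coeff_add[OF m m, OF ab]
        by (rule trans[OF co[OF A.UP_a_closed[OF ab]]]) (use ab in \<open>simp add: co\<close>)
    qed (rule m[OF A.UP_a_closed[OF ab]] B.UP_a_closed[OF m m, OF ab])+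
  next
    show "?m \<one>\<^bsub>UP A\<^esub> = \<one>\<^bsub>UP B\<^esub>"
    proof (rule B.up_eqI)
      fix n
      show "coeff (UP B) (?m \<one>\<^bsub>UP A\<^esub>) n = coeff (UP B) \<one>\<^bsub>UP B\<^esub> n"
        by (rule trans[OF co[OF A.UP_one_closed]]) simp
    qed (rule m[OF A.UP_one_closed] B.UP_one_closed)+
  qed (rule m)
qed

section \<open>The image of the integers in a ring, and the reduction of a Galois ring modulo
  2\<close>

lemma (in ring) of_Z4_closed [simp]: "of_Z4 R k \<in> carrier R"
  by (simp add: of_Z4_def)

lemma (in ring) of_Z4_add: "of_Z4 R (j + k) = of_Z4 R j \<oplus> of_Z4 R k"
  by (simp add: of_Z4_def add.int_pow_mult)

lemma (in ring) of_Z4_mult: "of_Z4 R (j * k) = of_Z4 R j \<otimes> of_Z4 R k"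
  by (simp add: of_Z4_def add_pow_ldistr_int add.int_pow_pow mult.commute)

lemma (in ring) of_Z4_0: "of_Z4 R 0 = \<zero>"
  by (simp add: of_Z4_def add_pow_def)

lemma (in ring) of_Z4_1: "of_Z4 R 1 = \<one>"
  by (simp add: of_Z4_def)

lemma (in ring) of_Z4_2: "of_Z4 R 2 = \<one> \<oplus> \<one>"
  using of_Z4_add[of 1 1] by (simp add: of_Z4_1)

lemma (in ring) of_Z4_4: "of_Z4 R 4 = (\<one> \<oplus> \<one>) \<oplus> (\<one> \<oplus> \<one>)"
  using of_Z4_add[of 2 2] by (simp add: of_Z4_2)

text \<open>An intrinsic substitute for the presentation Z_4[X]/(f): all later arguments about
  Galois rings use only these properties. \<open>kernel\<close> makes the kernel consist of
  multiples of 2, and \<open>four\<close> and \<open>two\<close> together fix the characteristic as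
  exactly 4.\<close>

locale galois_reduction =
  R?: cring R + K: field K for R (structure) and K (structure) +
  fixes \<theta> and r :: nat
  assumes hom: "\<theta> \<in> ring_hom R K"
    and surj: "\<theta> ` carrier R = carrier K"
    and finite_K: "finite (carrier K)"
    and card_K: "card (carrier K) = 2 ^ r"
    and kernel: "x \<in> carrier R \<Longrightarrow> \<theta> x = \<zero>\<^bsub>K\<^esub> \<Longrightarrow> \<exists>y\<in>carrier R. x = of_Z4 R 2 \<otimes> y"
    and four: "of_Z4 R 4 = \<zero>"
    and two: "of_Z4 R 2 \<noteq> \<zero>"
    and r_pos: "r > 0"

text \<open>Serves the proof that 2 is nonzero in the Galois ring, with 2 in the role of
  \<open>t\<close> and the defining polynomial in that of \<open>f\<close>.\<close>

lemma (in cring) mult_one_minus_eq_zero: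
  assumes "t \<in> carrier R" "c \<in> carrier R" "f \<in> carrier R" and "t = t \<otimes> c \<otimes> f"
  shows "t \<otimes> (\<one> \<ominus> c \<otimes> f) = \<zero>"
proof -
  have "t \<otimes> (\<one> \<ominus> c \<otimes> f) = t \<ominus> t \<otimes> c \<otimes> f" using assms(1-3) by algebra
  also have "\<dots> = t \<ominus> t" using assms(4) by simp
  finally show ?thesis using assms(1) by (simp add: minus_eq r_neg)
qed

lemma zero_FactRing: "\<zero>\<^bsub>R Quot I\<^esub> = I"
  by (simp add: FactRing_def)

text \<open>The residue field is Z_2[X] modulo the reduction of \<open>f\<close>. The map sends the
  class of a polynomial over Z_4 to the class of its reduction, which is well defined because
  multiples of \<open>f\<close> reduce to multiples of the reduced \<open>f\<close>.\<close>

lemma galois_ring4_reduction: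
  assumes gr: "galois_ring4 r R" and r: "r > 0"
  shows "\<exists>(K :: (nat \<Rightarrow> int) set ring) \<theta>. galois_reduction R K \<theta> r"
proof -
  let ?A = "residue_ring 4" and ?B = "residue_ring 2"
  let ?P = "UP ?A" and ?Q = "UP ?B"
  obtain f where f: "f \<in> carrier ?P" and degf: "deg ?A f = r"
    and lc: "coeff ?P f r \<in> Units ?A"
    and irr: "ring_irreducible\<^bsub>?Q\<^esub> (\<lambda>n. coeff ?P f n mod 2)"
    and iso: "R \<simeq> ?P Quot (PIdl\<^bsub>?P\<^esub> f)" and R: "ring R"
    using gr unfolding galois_ring4_def basic_irreducible_def by auto
  interpret R: ring R by (rule R)
  have "cring ?A" using residues.cring[of 4] by (simp add: residues_def)
  then interpret A: cring ?A .
  have fB: "field ?B" using residues_prime.is_field[of 2] by (simp add: residues_prime_def)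
  interpret B: field ?B by (rule fB)
  interpret P: UP_cring ?A ?P by unfold_locales
  interpret Q: UP_domain ?B ?Q by unfold_locales
  have carA: "carrier ?A = {0..3}" and carB: "carrier ?B = {0..1}"
    by (simp_all add: residue_ring_def)
  define red where "red = (\<lambda>a n. coeff ?P a n mod 2)"
  have "(\<lambda>k. k mod 2) \<in> ring_hom ?A ?B"
    by (intro ring_hom_memI)
      (auto simp: residue_ring_def mod_mod_cancel mod_add_eq mod_mult_eq)
  from UP_map_ring_hom[OF A.is_cring B.is_cring this]
  have red_hom: "red \<in> ring_hom ?P ?Q" by (simp add: red_def)
  then interpret red: ring_hom_cring ?P ?Q red
    by (intro ring_hom_cring.intro ring_hom_cring_axioms.intro P.P.is_cring Q.P.is_cring)
  have coP: "coeff ?P a = a" if "a \<in> carrier ?P" for a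
    using that by (simp add: UP_def)
  have coQ: "coeff ?Q a = a" if "a \<in> carrier ?Q" for a
    using that by (simp add: UP_def)
  let ?f2 = "red f"
  have f2: "?f2 \<in> carrier ?Q" using f by simp
  have irr2: "ring_irreducible\<^bsub>?Q\<^esub> ?f2" using irr by (simp add: red_def)
  have f20: "?f2 \<noteq> \<zero>\<^bsub>?Q\<^esub>" using irr2 by (simp add: ring_irreducible_def)
  \<comment> \<open>Polynomials are coefficient functions into the integers, so one with values 0
    and 1 belongs to both polynomial rings and is its own lift to Z_4[X].\<close>
  have QP: "b \<in> carrier ?P" "red b = b" if b: "b \<in> carrier ?Q" for b
  proof -
    have b01: "b n \<in> {0..1}" for n using b carB by (auto simp: UP_def up_def Pi_def)
    then have b03: "b n \<in> {0..3}" for n using order_trans[of "b n" 1 3] by auto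
    obtain m where "bound 0 m b" using b by (auto simp: UP_def up_def residue_ring_def)
    then have "b \<in> up ?A"
      using b03 by (intro mem_upI exI[of _ m]) (auto simp: carA residue_ring_def)
    then show bP: "b \<in> carrier ?P" by (simp add: UP_def)
    show "red b = b"
    proof
      fix n
      have "b n = 0 \<or> b n = 1" using b01[of n] by auto
      then show "red b n = b n" unfolding red_def coP[OF bP] by auto
    qed
  qed
  \<comment> \<open>The constant 2 is written as a sum of two ones. Over Z_4, doubling has as kernel
    the polynomials with even coefficients, and these are also its image; the next two facts supply
    this exactness.\<close>
  have dbl: "coeff ?P ((\<one>\<^bsub>?P\<^esub> \<oplus>\<^bsub>?P\<^esub> \<one>\<^bsub>?P\<^esub>) \<otimes>\<^bsub>?P\<^esub> a) n = 2 * coeff ?P a n mod 4"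
    if "a \<in> carrier ?P" for a n
    using that by (simp add: P.P.l_distr) (simp add: residue_ring_def)
  have red0D: "\<exists>c\<in>carrier ?P. a = (\<one>\<^bsub>?P\<^esub> \<oplus>\<^bsub>?P\<^esub> \<one>\<^bsub>?P\<^esub>) \<otimes>\<^bsub>?P\<^esub> c"
    if a: "a \<in> carrier ?P" and z: "red a = \<zero>\<^bsub>?Q\<^esub>" for a
  proof -
    define c where "c = (\<lambda>n. a n div 2)"
    have a03: "a n \<in> {0..3}" for n using a carA by (auto simp: UP_def up_def Pi_def)
    have ev: "a n mod 2 = 0" for n
      using fun_cong[OF z, of n] unfolding red_def coP[OF a] by (simp add: UP_def residue_ring_def)
    obtain m where "bound 0 m a" using a by (auto simp: UP_def up_def residue_ring_def)
    then have "bound 0 m c" by (auto simp: bound_def c_def)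
    moreover have "c n \<in> {0..3}" for n using a03[of n] by (auto simp: c_def)
    ultimately have "c \<in> up ?A"
      by (intro mem_upI exI[of _ m]) (auto simp: carA residue_ring_def)
    then have c: "c \<in> carrier ?P" by (simp add: UP_def)
    have "a = (\<one>\<^bsub>?P\<^esub> \<oplus>\<^bsub>?P\<^esub> \<one>\<^bsub>?P\<^esub>) \<otimes>\<^bsub>?P\<^esub> c"
    proof (rule P.up_eqI)
      fix n
      have "2 * c n mod 4 = a n" using a03[of n] ev[of n] unfolding c_def by auto
      then show "coeff ?P a n = coeff ?P ((\<one>\<^bsub>?P\<^esub> \<oplus>\<^bsub>?P\<^esub> \<one>\<^bsub>?P\<^esub>) \<otimes>\<^bsub>?P\<^esub> c) n"
        unfolding dbl[OF c] coP[OF a] coP[OF c] by simp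
    qed (use a c in auto)
    with c show ?thesis by blast
  qed
  have dbl0D: "red a = \<zero>\<^bsub>?Q\<^esub>"
    if a: "a \<in> carrier ?P" and z: "(\<one>\<^bsub>?P\<^esub> \<oplus>\<^bsub>?P\<^esub> \<one>\<^bsub>?P\<^esub>) \<otimes>\<^bsub>?P\<^esub> a = \<zero>\<^bsub>?P\<^esub>" for a
  proof (rule Q.up_eqI)
    fix n
    have "2 * coeff ?P a n mod 4 = 0" unfolding dbl[OF a, symmetric] z
      by (simp add: P.coeff_zero) (simp add: residue_ring_def)
    then have "coeff ?P a n mod 2 = 0" by presburger
    then have "red a n = 0" by (simp add: red_def)
    then show "coeff ?Q (red a) n = coeff ?Q \<zero>\<^bsub>?Q\<^esub> n"
      using coQ[of "red a"] a by (simp add: Q.coeff_zero) (simp add: residue_ring_def)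
  qed (use a in auto)

  \<comment> \<open>A unit of Z_4 is odd, hence the degree \<open>r\<close> survives the reduction;
    this makes the residue field have 2^r elements.\<close>
  have "\<not> even (coeff ?P f r)"
  proof
    assume e: "even (coeff ?P f r)"
    obtain v where "coeff ?P f r * v mod 4 = 1"
      using lc by (auto simp: Units_def residue_ring_def)
    then have "odd (coeff ?P f r * v)" by (metis dvd_mod_iff even_numeral odd_one)
    with e show False by auto
  qed
  then have lc2: "red f r = 1" by (auto simp: red_def odd_iff_mod_2_eq_one)
  have deg2: "deg ?B ?f2 = r"
  proof (rule antisym)
    show "deg ?B ?f2 \<le> r"
    proof (rule Q.deg_aboveI[OF _ f2])
      fix m assume "r < m"
      then have "coeff ?P f m = \<zero>\<^bsub>?A\<^esub>" using P.deg_aboveD[of f m] f degf by simp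
      then show "coeff ?Q ?f2 m = \<zero>\<^bsub>?B\<^esub>"
        unfolding coQ[OF f2] by (simp add: red_def residue_ring_def)
    qed
    show "r \<le> deg ?B ?f2"
      by (rule Q.deg_belowI) (use f2 in \<open>simp_all add: coQ lc2\<close>, simp add: residue_ring_def)
  qed
  let ?J = "PIdl\<^bsub>?Q\<^esub> ?f2" and ?I = "PIdl\<^bsub>?P\<^esub> f"
  let ?K = "?Q Quot ?J" and ?S = "?P Quot ?I"
  interpret K: field ?K by (rule UP_Quot_irreducible_field[OF fB f2 irr2])
  interpret I: ideal ?I ?P by (rule P.P.cgenideal_ideal[OF f])
  interpret J: ideal ?J ?Q by (rule Q.P.cgenideal_ideal[OF f2])
  interpret pI: ring_hom_cring ?P ?S "(+>\<^bsub>?P\<^esub>) ?I" by (rule I.rcos_ring_hom_cring[OF P.P.is_cring])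
  interpret pJ: ring_hom_cring ?Q ?K "(+>\<^bsub>?Q\<^esub>) ?J" by (rule J.rcos_ring_hom_cring[OF Q.P.is_cring])
  obtain \<phi> where phi: "\<phi> \<in> ring_hom R ?S" and bij: "bij_betw \<phi> (carrier R) (carrier ?S)"
    using iso by (auto simp: is_ring_iso_def ring_iso_def)
  interpret phi: ring_hom_ring R ?S \<phi> by (rule ring_hom_ringI2[OF R pI.S.ring_axioms phi])
  have inj: "x = y" if "\<phi> x = \<phi> y" "x \<in> carrier R" "y \<in> carrier R" for x y
    using bij that by (auto simp: bij_betw_def inj_on_def)
  \<comment> \<open>\<open>galois_ring4\<close> only grants a ring; commutativity is pulled back
    along the injective \<open>\<phi>\<close>.\<close>
  have "cring R"
  proof (rule cring.intro[OF R comm_monoid.intro[OF R.is_monoid]], unfold_locales)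
    fix x y assume xy: "x \<in> carrier R" "y \<in> carrier R"
    then show "x \<otimes>\<^bsub>R\<^esub> y = y \<otimes>\<^bsub>R\<^esub> x" by (intro inj) (auto simp: pI.S.m_comm)
  qed
  then interpret R: cring R .
  have lift: "\<exists>a. a \<in> carrier ?P \<and> \<phi> x = ?I +>\<^bsub>?P\<^esub> a" if "x \<in> carrier R" for x
  proof -
    have "\<phi> x \<in> carrier ?S" using that by (rule phi.hom_closed)
    then show ?thesis unfolding FactRing_def A_RCOSETS_def' by auto
  qed
  have unlift: "\<exists>x\<in>carrier R. \<phi> x = ?I +>\<^bsub>?P\<^esub> a" if "a \<in> carrier ?P" for a
  proof -
    have "?I +>\<^bsub>?P\<^esub> a \<in> \<phi> ` carrier R"
      using pI.hom_closed[OF that] bij_betw_imp_surj_on[OF bij] by (simp only:)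
    then show ?thesis by (metis imageE)
  qed
  define \<theta> where "\<theta> = (\<lambda>x. ?J +>\<^bsub>?Q\<^esub> red (SOME a. a \<in> carrier ?P \<and> \<phi> x = ?I +>\<^bsub>?P\<^esub> a))"
  have theta: "\<theta> x = ?J +>\<^bsub>?Q\<^esub> red a"
    if x: "x \<in> carrier R" and a: "a \<in> carrier ?P" and eq: "\<phi> x = ?I +>\<^bsub>?P\<^esub> a" for x a
  \<comment> \<open>Two lifts of the same class differ by a multiple of \<open>f\<close>, so the
    value does not depend on the lift that \<open>SOME\<close> picks.\<close>
  proof -
    define b where "b = (SOME a. a \<in> carrier ?P \<and> \<phi> x = ?I +>\<^bsub>?P\<^esub> a)"
    have b: "b \<in> carrier ?P" "\<phi> x = ?I +>\<^bsub>?P\<^esub> b"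
      using someI_ex[OF lift[OF x]] by (auto simp: b_def)
    have "b \<ominus>\<^bsub>?P\<^esub> a \<in> ?I"
      using P.P.quotient_eq_iff_same_a_r_cos[OF I.ideal_axioms b(1) a] b(2) eq by simp
    then obtain h where h: "h \<in> carrier ?P" "b \<ominus>\<^bsub>?P\<^esub> a = h \<otimes>\<^bsub>?P\<^esub> f"
      unfolding cgenideal_def by auto
    have "red b \<ominus>\<^bsub>?Q\<^esub> red a = red (b \<ominus>\<^bsub>?P\<^esub> a)"
      using a b(1) by (simp add: a_minus_def)
    also have "\<dots> = red h \<otimes>\<^bsub>?Q\<^esub> ?f2" using h f by simp
    finally have "red b \<ominus>\<^bsub>?Q\<^esub> red a \<in> ?J" using h(1) unfolding cgenideal_def by auto
    then have "?J +>\<^bsub>?Q\<^esub> red b = ?J +>\<^bsub>?Q\<^esub> red a"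
      using Q.P.quotient_eq_iff_same_a_r_cos[OF J.ideal_axioms, of "red b" "red a"] a b(1) by simp
    then show ?thesis by (simp add: \<theta>_def b_def)
  qed
  have "galois_reduction R ?K \<theta> r"
  proof (intro galois_reduction.intro galois_reduction_axioms.intro)
    show "\<theta> \<in> ring_hom R ?K"
    proof (rule ring_hom_memI)
      fix x assume "x \<in> carrier R"
      with lift obtain a where a: "a \<in> carrier ?P" "\<phi> x = ?I +>\<^bsub>?P\<^esub> a" by blast
      show "\<theta> x \<in> carrier ?K" unfolding theta[OF \<open>x \<in> carrier R\<close> a] using a(1) by simp
    next
      fix x y assume xy: "x \<in> carrier R" "y \<in> carrier R"
      obtain a where a: "a \<in> carrier ?P" "\<phi> x = ?I +>\<^bsub>?P\<^esub> a" using lift[OF xy(1)] by blast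
      obtain b where b: "b \<in> carrier ?P" "\<phi> y = ?I +>\<^bsub>?P\<^esub> b" using lift[OF xy(2)] by blast
      have "\<phi> (x \<otimes>\<^bsub>R\<^esub> y) = ?I +>\<^bsub>?P\<^esub> (a \<otimes>\<^bsub>?P\<^esub> b)" "\<phi> (x \<oplus>\<^bsub>R\<^esub> y) = ?I +>\<^bsub>?P\<^esub> (a \<oplus>\<^bsub>?P\<^esub> b)"
        using xy a b by simp_all
      from theta[OF _ _ this(1)] theta[OF _ _ this(2)] theta[OF xy(1) a] theta[OF xy(2) b]
      show "\<theta> (x \<otimes>\<^bsub>R\<^esub> y) = \<theta> x \<otimes>\<^bsub>?K\<^esub> \<theta> y" "\<theta> (x \<oplus>\<^bsub>R\<^esub> y) = \<theta> x \<oplus>\<^bsub>?K\<^esub> \<theta> y"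
        using xy a(1) b(1) by simp_all
    next
      have "\<phi> \<one>\<^bsub>R\<^esub> = ?I +>\<^bsub>?P\<^esub> \<one>\<^bsub>?P\<^esub>" by simp
      from theta[OF _ _ this] show "\<theta> \<one>\<^bsub>R\<^esub> = \<one>\<^bsub>?K\<^esub>" by simp
    qed
    show "\<theta> ` carrier R = carrier ?K"
    proof (intro equalityI subsetI)
      fix X assume "X \<in> \<theta> ` carrier R"
      with \<open>\<theta> \<in> ring_hom R ?K\<close> show "X \<in> carrier ?K" by (auto simp: ring_hom_closed)
    next
      fix X assume "X \<in> carrier ?K"
      then obtain b where b: "b \<in> carrier ?Q" "X = ?J +>\<^bsub>?Q\<^esub> b"
        unfolding FactRing_def A_RCOSETS_def' by auto
      obtain x where x: "x \<in> carrier R" "\<phi> x = ?I +>\<^bsub>?P\<^esub> b" using unlift[OF QP(1)[OF b(1)]] by blast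
      have "\<theta> x = X" using theta[OF x(1) QP(1)[OF b(1)] x(2)] b by (simp add: QP(2))
      with x(1) show "X \<in> \<theta> ` carrier R" by blast
    qed
    have finB: "finite (carrier ?B)" and cardB: "card (carrier ?B) = 2"
      unfolding carB by simp_all
    show "finite (carrier ?K)" by (rule finite_UP_Quot[OF fB finB f2 f20])
    show "card (carrier ?K) = 2 ^ r"
      using card_UP_Quot[OF fB finB f2 f20] by (simp add: cardB deg2)
  next
    fix x assume x: "x \<in> carrier R" "\<theta> x = \<zero>\<^bsub>?K\<^esub>"
    obtain a where a: "a \<in> carrier ?P" "\<phi> x = ?I +>\<^bsub>?P\<^esub> a" using lift[OF x(1)] by blast
    have "?J +>\<^bsub>?Q\<^esub> red a = ?J" using theta[OF x(1) a] x(2) unfolding zero_FactRing by (rule trans[OF sym])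
    then have "red a \<in> ?J" using J.a_rcos_self[of "red a"] a(1) by simp
    then obtain h where h: "h \<in> carrier ?Q" "red a = h \<otimes>\<^bsub>?Q\<^esub> ?f2"
      unfolding cgenideal_def by auto
    \<comment> \<open>Subtracting a lift of the multiple of \<open>?f2\<close> leaves the class of
      \<open>a\<close> unchanged and makes the reduction zero, so the corrected representative is
      twice some polynomial.\<close>
    let ?d = "a \<ominus>\<^bsub>?P\<^esub> h \<otimes>\<^bsub>?P\<^esub> f"
    have "red ?d = red a \<ominus>\<^bsub>?Q\<^esub> red h \<otimes>\<^bsub>?Q\<^esub> ?f2"
      using a(1) QP(1)[OF h(1)] f by (simp add: a_minus_def)
    then have "red ?d = \<zero>\<^bsub>?Q\<^esub>" using h f2 by (simp add: QP(2) Q.P.r_right_minus_eq)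
    then obtain c where c: "c \<in> carrier ?P" "?d = (\<one>\<^bsub>?P\<^esub> \<oplus>\<^bsub>?P\<^esub> \<one>\<^bsub>?P\<^esub>) \<otimes>\<^bsub>?P\<^esub> c"
      using red0D[of ?d] a(1) QP(1)[OF h(1)] f by auto
    obtain y where y: "y \<in> carrier R" "\<phi> y = ?I +>\<^bsub>?P\<^esub> c" using unlift[OF c(1)] by blast
    have "a \<ominus>\<^bsub>?P\<^esub> ?d = h \<otimes>\<^bsub>?P\<^esub> f"
      using a(1) QP(1)[OF h(1)] f
      by (simp add: P.P.minus_eq P.P.minus_add P.P.a_assoc[symmetric] P.P.r_neg)
    then have "a \<ominus>\<^bsub>?P\<^esub> ?d \<in> ?I" using QP(1)[OF h(1)] unfolding cgenideal_def by auto
    then have "?I +>\<^bsub>?P\<^esub> a = ?I +>\<^bsub>?P\<^esub> ?d"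
      using P.P.quotient_eq_iff_same_a_r_cos[OF I.ideal_axioms, of a ?d] a(1) QP(1)[OF h(1)] f by simp
    then have "\<phi> x = \<phi> (of_Z4 R 2 \<otimes>\<^bsub>R\<^esub> y)"
      using a(2) c y by (simp add: R.of_Z4_2)
    then have "x = of_Z4 R 2 \<otimes>\<^bsub>R\<^esub> y" using x(1) y(1) by (intro inj) auto
    with y(1) show "\<exists>y\<in>carrier R. x = of_Z4 R 2 \<otimes>\<^bsub>R\<^esub> y" by blast
  next
    let ?t = "\<one>\<^bsub>?P\<^esub> \<oplus>\<^bsub>?P\<^esub> \<one>\<^bsub>?P\<^esub>"
    have "?t \<oplus>\<^bsub>?P\<^esub> ?t = \<zero>\<^bsub>?P\<^esub>"
    proof (rule P.up_eqI)
      fix n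
      show "coeff ?P (?t \<oplus>\<^bsub>?P\<^esub> ?t) n = coeff ?P \<zero>\<^bsub>?P\<^esub> n"
        by simp (simp add: residue_ring_def)
    qed auto
    then have "\<phi> (of_Z4 R 4) = \<phi> \<zero>\<^bsub>R\<^esub>"
      by (simp add: R.of_Z4_4 flip: pI.hom_one pI.hom_add)
    then show "of_Z4 R 4 = \<zero>\<^bsub>R\<^esub>" by (rule inj) auto
    show "of_Z4 R 2 \<noteq> \<zero>\<^bsub>R\<^esub>"
    \<comment> \<open>If 2 = h f in Z_4[X], then \<open>h\<close> reduces to zero because Z_2[X] is
      a domain and the reduced \<open>f\<close> is nonzero. So h = 2c and 2(1 - c f) = 0, whence 1 =
      c f modulo 2; the irreducible reduction of \<open>f\<close> would be a unit.\<close>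
    proof
      assume "of_Z4 R 2 = \<zero>\<^bsub>R\<^esub>"
      then have "\<phi> (\<one>\<^bsub>R\<^esub> \<oplus>\<^bsub>R\<^esub> \<one>\<^bsub>R\<^esub>) = \<phi> \<zero>\<^bsub>R\<^esub>" by (simp add: R.of_Z4_2)
      then have "?I +>\<^bsub>?P\<^esub> ?t = ?I" using pI.hom_add[of "\<one>\<^bsub>?P\<^esub>" "\<one>\<^bsub>?P\<^esub>"]
          zero_FactRing[of ?P ?I] by simp
      then have "?t \<in> ?I" using I.a_rcos_self[of ?t] by simp
      then obtain h where h: "h \<in> carrier ?P" "?t = h \<otimes>\<^bsub>?P\<^esub> f"
        unfolding cgenideal_def by auto
      have "red ?t = \<zero>\<^bsub>?Q\<^esub>"
        using dbl0D[of ?t] \<open>?t \<oplus>\<^bsub>?P\<^esub> ?t = \<zero>\<^bsub>?P\<^esub>\<close> by (simp add: P.P.l_distr)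
      then have "red h \<otimes>\<^bsub>?Q\<^esub> ?f2 = \<zero>\<^bsub>?Q\<^esub>" using h f by simp
      then have "red h = \<zero>\<^bsub>?Q\<^esub>" using f20 h(1) f2 Q.UP_integral[of "red h" ?f2] by auto
      then obtain c where c: "c \<in> carrier ?P" "h = ?t \<otimes>\<^bsub>?P\<^esub> c" using red0D[OF h(1)] by blast
      let ?u = "\<one>\<^bsub>?P\<^esub> \<ominus>\<^bsub>?P\<^esub> c \<otimes>\<^bsub>?P\<^esub> f"
      have "?t \<otimes>\<^bsub>?P\<^esub> ?u = \<zero>\<^bsub>?P\<^esub>"
        by (rule P.P.mult_one_minus_eq_zero) (use h(2) c f in simp_all)
      then have "red ?u = \<zero>\<^bsub>?Q\<^esub>" using c(1) f by (intro dbl0D) auto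
      moreover have "red ?u = \<one>\<^bsub>?Q\<^esub> \<ominus>\<^bsub>?Q\<^esub> red c \<otimes>\<^bsub>?Q\<^esub> ?f2"
        using c(1) f by (simp add: a_minus_def)
      ultimately have "\<one>\<^bsub>?Q\<^esub> = red c \<otimes>\<^bsub>?Q\<^esub> ?f2"
        using c(1) f by (simp add: Q.P.r_right_minus_eq)
      then have "?f2 \<in> Units ?Q" using c(1) f f2 by (auto simp: Units_def Q.P.m_comm)
      then show False using irr2 by (simp add: ring_irreducible_def Divisibility.irreducible_def)
    qed
  qed (fact R.is_cring K.field_axioms r)+
  then show ?thesis by blast
qed

section \<open>Roots of unity and the trace\<close>

lemma (in cring) square_add_mult:
  assumes "t \<in> carrier R" "y \<in> carrier R" "z \<in> carrier R"
  shows "(y \<oplus> t \<otimes> z) [^] (2::nat) =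
    y [^] (2::nat) \<oplus> (t \<oplus> t) \<otimes> (y \<otimes> z) \<oplus> (t \<otimes> t) \<otimes> (z \<otimes> z)"
  unfolding numeral_2_eq_2 using assms by simp algebra

lemma (in cring) geometric_sum:
  assumes x: "x \<in> carrier R"
  shows "(x \<ominus> \<one>) \<otimes> (\<Oplus>k\<in>{..<n::nat}. x [^] k) = x [^] n \<ominus> \<one>"
proof (induction n)
  case (Suc n)
  define w where "w = x [^] n"
  have w: "w \<in> carrier R" using x by (simp add: w_def)
  have "(x \<ominus> \<one>) \<otimes> (\<Oplus>k\<in>{..<Suc n}. x [^] k) = (x \<ominus> \<one>) \<otimes> (w \<oplus> (\<Oplus>k\<in>{..<n}. x [^] k))"
    using x by (simp add: lessThan_Suc w_def)
  also have "\<dots> = (x \<ominus> \<one>) \<otimes> w \<oplus> (w \<ominus> \<one>)"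
    using x w by (simp add: r_distr Suc w_def)
  also have "\<dots> = x \<otimes> w \<ominus> \<one>" using w x by algebra
  finally show ?case using nat_pow_Suc2[OF x, of n] by (simp add: w_def)
qed (use x in \<open>simp add: minus_eq r_neg\<close>)

section \<open>Units and roots of unity of odd order under the reduction\<close>

context galois_reduction
begin

sublocale hom: ring_hom_cring R K \<theta>
  by (intro ring_hom_cring.intro ring_hom_cring_axioms.intro hom R.is_cring K.is_cring)

lemma two_add_two: "of_Z4 R 2 \<oplus> of_Z4 R 2 = \<zero>"
  using R.of_Z4_add[of 2 2] by (simp add: four)

lemma two_times_two: "of_Z4 R 2 \<otimes> of_Z4 R 2 = \<zero>"
  using R.of_Z4_mult[of 2 2] by (simp add: four)

lemma of_Z4_eqI:
  assumes "[j = k] (mod 4)"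
  shows "of_Z4 R j = of_Z4 R k"
proof -
  obtain d where "j = k + 4 * d" using cong_sym[OF assms] by (auto simp: cong_iff_lin)
  then show ?thesis using R.of_Z4_mult[of 4 d] by (simp add: R.of_Z4_add four)
qed

text \<open>The element 2 is nilpotent, and a field has no nilpotent element besides 0.\<close>

lemma hom_two: "\<theta> (of_Z4 R 2) = \<zero>\<^bsub>K\<^esub>"
proof -
  have "\<theta> (of_Z4 R 2) \<otimes>\<^bsub>K\<^esub> \<theta> (of_Z4 R 2) = \<zero>\<^bsub>K\<^esub>"
    by (simp add: two_times_two flip: hom.hom_mult)
  then show ?thesis by (auto simp: K.integral_iff)
qed

lemma eq_hom_imp_square_eq:
  assumes x: "x \<in> carrier R" and y: "y \<in> carrier R" and eq: "\<theta> x = \<theta> y"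
  shows "x [^] (2::nat) = y [^] (2::nat)"
proof -
  have "\<theta> (x \<ominus> y) = \<zero>\<^bsub>K\<^esub>" using x y eq by (simp add: R.minus_eq K.r_neg)
  then obtain z where z: "z \<in> carrier R" "x \<ominus> y = of_Z4 R 2 \<otimes> z"
    using kernel[of "x \<ominus> y"] x y by auto
  define t where "t = of_Z4 R 2"
  have t: "t \<in> carrier R" "t \<oplus> t = \<zero>" "t \<otimes> t = \<zero>"
    by (simp_all add: t_def two_add_two two_times_two)
  have "x = y \<oplus> (x \<ominus> y)" using x y by (simp add: R.minus_eq R.a_lcomm R.r_neg)
  then have x': "x = y \<oplus> t \<otimes> z" using z by (simp add: t_def)
  have "x [^] (2::nat) = y [^] (2::nat) \<oplus> (t \<oplus> t) \<otimes> (y \<otimes> z) \<oplus> (t \<otimes> t) \<otimes> (z \<otimes> z)"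
    unfolding x' using y z(1) t(1) by (intro R.square_add_mult)
  then show ?thesis using y z(1) by (simp add: t)
qed

lemma eq_hom_imp_eq:
  fixes m :: nat
  assumes x: "x \<in> carrier R" "x [^] m = \<one>" and y: "y \<in> carrier R" "y [^] m = \<one>"
    and m: "odd m" and eq: "\<theta> x = \<theta> y"
  shows "x = y"
proof -
  obtain k where k: "m = 2 * k + 1" using m by (elim oddE)
  \<comment> \<open>Raising to the power (m + 1)/2 = k + 1 undoes squaring on elements of order
    dividing the odd number \<open>m\<close>.\<close>
  have half: "z = (z [^] (2::nat)) [^] (k + 1)" if "z \<in> carrier R" "z [^] m = \<one>" for z
  proof -
    have "(z [^] (2::nat)) [^] (k + 1) = z [^] (2 * (k + 1))"
      using that(1) by (rule R.nat_pow_pow)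
    also have "\<dots> = z [^] (m + 1)" by (simp add: k)
    also have "\<dots> = z" using that by simp
    finally show ?thesis ..
  qed
  show ?thesis using half[OF x] half[OF y] eq_hom_imp_square_eq[OF x(1) y(1) eq] by simp
qed

lemma hom_pow_one_nonzero:
  fixes m :: nat
  assumes "x \<in> carrier R" "x [^] m = \<one>" "m > 0"
  shows "\<theta> x \<noteq> \<zero>\<^bsub>K\<^esub>"
proof
  assume "\<theta> x = \<zero>\<^bsub>K\<^esub>"
  moreover have "\<theta> x [^]\<^bsub>K\<^esub> m = \<one>\<^bsub>K\<^esub>" using assms by (simp flip: hom.hom_pow)
  ultimately show False using assms(3) K.nat_pow_zero[of m] by simp
qed

lemma unitI:
  assumes x: "x \<in> carrier R" and nz: "\<theta> x \<noteq> \<zero>\<^bsub>K\<^esub>"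
  shows "x \<in> Units R"
proof -
  have "\<theta> x \<in> Units K" using x nz K.field_Units by auto
  then have "inv\<^bsub>K\<^esub> \<theta> x \<in> carrier K" "\<theta> x \<otimes>\<^bsub>K\<^esub> inv\<^bsub>K\<^esub> \<theta> x = \<one>\<^bsub>K\<^esub>" by auto
  then obtain y where y: "y \<in> carrier R" "\<theta> x \<otimes>\<^bsub>K\<^esub> \<theta> y = \<one>\<^bsub>K\<^esub>"
    using surj by (metis imageE)
  \<comment> \<open>\<open>y\<close> inverts \<open>x\<close> only modulo 2. Since the product
    \<open>x \<otimes> y\<close> squares to 1, multiplying \<open>y\<close> by this product gives a
    true inverse.\<close>
  have "(x \<otimes> y) [^] (2::nat) = \<one> [^] (2::nat)"
    using x y by (intro eq_hom_imp_square_eq) auto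
  then have "x \<otimes> (y \<otimes> (x \<otimes> y)) = \<one>"
    using x y(1) by (simp add: numeral_2_eq_2 R.m_assoc)
  then show ?thesis using x y(1) by (auto simp: Units_def R.m_comm intro!: bexI[of _ "y \<otimes> (x \<otimes> y)"])
qed

text \<open>The roots can only be counted in the field \<open>K\<close>. There the images of the
  powers of \<open>\<xi>\<close> are \<open>m\<close> distinct roots of z^m = 1, hence all of them,
  and a root in \<open>R\<close> is recovered from its reduction because \<open>m\<close> is
  odd.\<close>

lemma roots_of_unity_powers:
  fixes m :: nat
  assumes m: "odd m" and \<xi>: "\<xi> \<in> carrier R" "\<xi> [^] m = \<one>"
    and ord: "\<And>k. 0 < k \<Longrightarrow> k < m \<Longrightarrow> \<xi> [^] k \<noteq> \<one>"
    and x: "x \<in> carrier R" "x [^] m = \<one>"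
  shows "\<exists>k<m. x = \<xi> [^] k"
proof -
  have pow1: "(\<xi> [^] k) [^] m = \<one>" for k :: nat
    using \<xi> by (simp add: R.nat_pow_pow mult.commute[of k]) (simp flip: R.nat_pow_pow)
  have dist: "\<theta> (\<xi> [^] i) \<noteq> \<theta> (\<xi> [^] j)" if "i < j" "j < m" for i j :: nat
  proof
    assume "\<theta> (\<xi> [^] i) = \<theta> (\<xi> [^] j)"
    then have eq: "\<xi> [^] i = \<xi> [^] j"
      using \<xi> m by (intro eq_hom_imp_eq[OF _ pow1 _ pow1]) auto
    \<comment> \<open>Cancellation of the i-th power of \<open>\<xi>\<close>, whose inverse is the
      power with exponent m - i.\<close>
    have "\<xi> [^] (j - i) = \<xi> [^] (j - i) \<otimes> (\<xi> [^] i \<otimes> \<xi> [^] (m - i))"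
      using \<xi> that by (simp add: R.nat_pow_mult)
    also have "\<dots> = \<xi> [^] (j - i) \<otimes> \<xi> [^] i \<otimes> \<xi> [^] (m - i)"
      using \<xi> by (simp add: R.m_assoc)
    also have "\<dots> = \<xi> [^] j \<otimes> \<xi> [^] (m - i)"
      using \<xi> that by (simp add: R.nat_pow_mult)
    also have "\<dots> = \<xi> [^] i \<otimes> \<xi> [^] (m - i)" by (simp add: eq)
    also have "\<dots> = \<one>" using \<xi> that by (simp add: R.nat_pow_mult)
    finally show False using ord[of "j - i"] that by auto
  qed
  let ?Z = "{z \<in> carrier K. z [^]\<^bsub>K\<^esub> m = \<one>\<^bsub>K\<^esub>}"
  have fin: "finite ?Z" using finite_K by auto
  have inj: "inj_on (\<lambda>k. \<theta> (\<xi> [^] k)) {..<m}"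
    using dist by (intro linorder_inj_onI) auto
  have sub: "(\<lambda>k. \<theta> (\<xi> [^] k)) ` {..<m} \<subseteq> ?Z"
    using \<xi> pow1 by (auto simp flip: hom.hom_pow)
  have "card ?Z \<le> card ((\<lambda>k. \<theta> (\<xi> [^] k)) ` {..<m})"
    using K.num_roots_le_deg[OF finite_K, of m] m by (auto simp: card_image[OF inj] elim: oddE)
  with card_seteq[OF fin sub] have "(\<lambda>k. \<theta> (\<xi> [^] k)) ` {..<m} = ?Z" by blast
  moreover have "\<theta> x \<in> ?Z" using x by (auto simp flip: hom.hom_pow)
  ultimately obtain k where k: "k < m" "\<theta> x = \<theta> (\<xi> [^] k)" by (auto simp: image_iff)
  then have "x = \<xi> [^] k" using x \<xi> m by (intro eq_hom_imp_eq[OF _ _ _ pow1]) auto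
  with k(1) show ?thesis by blast
qed

end

text \<open>Replaces the order in the group \<open>units_of R\<close> by conditions on powers in
  \<open>R\<close> itself; the power n - 1 of \<open>x\<close> serves as its inverse.\<close>

lemma (in ring) unit_of_order_iff:
  assumes "n > 0"
  shows "unit_of_order R n x \<longleftrightarrow>
    x \<in> carrier R \<and> x [^] n = \<one> \<and> (\<forall>k. x [^] k = \<one> \<longrightarrow> n dvd k)"
proof -
  interpret U: group "units_of R" by (rule units_group)
  have pow: "x [^]\<^bsub>units_of R\<^esub> k = x [^] k" if "x \<in> Units R" for k :: nat
    using that by (rule units_of_pow)
  have iff: "x [^] k = \<one> \<longleftrightarrow> U.ord x dvd k" if "x \<in> Units R" for k
    using U.pow_eq_id[of x k] that by (simp add: pow units_of_carrier units_of_one)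
  show ?thesis
  proof
    assume "unit_of_order R n x"
    then show "x \<in> carrier R \<and> x [^] n = \<one> \<and> (\<forall>k. x [^] k = \<one> \<longrightarrow> n dvd k)"
      by (auto simp: unit_of_order_def iff)
  next
    assume R: "x \<in> carrier R \<and> x [^] n = \<one> \<and> (\<forall>k. x [^] k = \<one> \<longrightarrow> n dvd k)"
    then have "x \<otimes> x [^] (n - 1) = \<one>" "x [^] (n - 1) \<otimes> x = \<one>"
      using assms nat_pow_Suc2[of x "n - 1"] nat_pow_Suc[of x "n - 1"] by simp_all
    with R have u: "x \<in> Units R" by (auto simp: Units_def intro!: bexI[of _ "x [^] (n - 1)"])
    then have "U.ord x dvd n" "n dvd U.ord x" using R iff by auto
    with u show "unit_of_order R n x" by (simp add: unit_of_order_def dvd_antisym)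
  qed
qed

section \<open>The Teichmuller set, Frobenius and trace on roots of unity\<close>

context galois_reduction
begin

lemma odd_order: "odd ((2::nat) ^ r - 1)"
  using r_pos by simp

text \<open>A lift \<open>x\<close> of a generator of the multiplicative group of \<open>K\<close>
  satisfies x^m = 1 only modulo 2, where m = 2^r - 1. Its square satisfies the equation exactly, and
  its reduction still has order \<open>m\<close> because \<open>m\<close> is odd.\<close>

lemma unit_of_max_order: "\<exists>\<xi>. unit_of_order R (2 ^ r - 1) \<xi>"
proof -
  let ?m = "2 ^ r - 1 :: nat"
  interpret M: group "Multiplicative_Group.mult_of K"
    rewrites "([^]\<^bsub>Multiplicative_Group.mult_of K\<^esub>) = (([^]\<^bsub>K\<^esub>) :: _ \<Rightarrow> nat \<Rightarrow> _)"
      and "\<one>\<^bsub>Multiplicative_Group.mult_of K\<^esub> = \<one>\<^bsub>K\<^esub>"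
    by (rule K.field_mult_group) (simp_all add: Multiplicative_Group.mult_of_simps)
  have finM: "finite (carrier (Multiplicative_Group.mult_of K))" using finite_K by simp
  obtain a where a: "a \<in> carrier (Multiplicative_Group.mult_of K)"
    "carrier (Multiplicative_Group.mult_of K) = {a [^]\<^bsub>K\<^esub> i |i::nat. i \<in> UNIV}"
    using K.finite_field_mult_group_has_gen[OF finite_K] by blast
  have "carrier (Multiplicative_Group.mult_of K) = generate (Multiplicative_Group.mult_of K) {a}"
    using M.generate_pow_on_finite_carrier[OF finM a(1)] a(2) by auto
  then have "M.ord a = card (carrier (Multiplicative_Group.mult_of K))"
    using M.generate_pow_card[OF a(1)] by simp
  also have "\<dots> = ?m" using finite_K card_K by simp
  finally have ord: "a [^]\<^bsub>K\<^esub> k = \<one>\<^bsub>K\<^esub> \<longleftrightarrow> ?m dvd k" for k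
    using M.pow_eq_id[OF a(1)] by simp
  have "a \<in> \<theta> ` carrier R" using a(1) surj by simp
  then obtain x where x: "x \<in> carrier R" "\<theta> x = a" by blast
  have "\<theta> (x [^] ?m) = \<theta> \<one>" using x ord[of ?m] by simp
  then have "(x [^] ?m) [^] (2::nat) = \<one> [^] (2::nat)" using x by (intro eq_hom_imp_square_eq) auto
  then have "(x [^] (2::nat)) [^] ?m = \<one>" using x by (simp add: R.nat_pow_pow mult.commute)
  moreover have "?m dvd k" if "(x [^] (2::nat)) [^] k = \<one>" for k
  proof -
    have "a \<in> carrier K" using a(1) by simp
    then have "a [^]\<^bsub>K\<^esub> (2 * k) = \<theta> ((x [^] (2::nat)) [^] k)" using x by (simp only: K.nat_pow_pow hom.hom_pow R.nat_pow_closed)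
    then have "?m dvd 2 * k" using that ord by simp
    moreover have "coprime ?m 2" using odd_order by simp
    ultimately show ?thesis by (simp add: coprime_dvd_mult_right_iff)
  qed
  moreover have "?m > 0" using odd_pos[OF odd_order] .
  ultimately have "unit_of_order R ?m (x [^] (2::nat))"
    using x by (subst R.unit_of_order_iff) auto
  then show ?thesis ..
qed

text \<open>Eliminates the chosen generator: whichever one \<open>SOME\<close> picks, its powers
  exhaust the roots of unity, so membership becomes an equation.\<close>

lemma teichmuller_eq:
  "teichmuller R r = insert \<zero> {x \<in> carrier R. x [^] (2 ^ r - 1 :: nat) = \<one>}"
proof -
  let ?m = "2 ^ r - 1 :: nat"
  define \<xi> where "\<xi> = (SOME x. unit_of_order R ?m x)"
  have m: "?m > 0" using odd_pos[OF odd_order] .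
  have "unit_of_order R ?m \<xi>" unfolding \<xi>_def by (rule someI_ex[OF unit_of_max_order])
  then have \<xi>: "\<xi> \<in> carrier R" "\<xi> [^] ?m = \<one>" "\<And>k. \<xi> [^] k = \<one> \<Longrightarrow> ?m dvd k"
    using R.unit_of_order_iff[OF m] by auto
  have "{\<xi> [^] k |k::nat. k < ?m} = {x \<in> carrier R. x [^] ?m = \<one>}"
  proof (intro equalityI subsetI)
    fix x assume "x \<in> {\<xi> [^] k |k::nat. k < ?m}"
    then obtain k :: nat where "x = \<xi> [^] k" by auto
    moreover have "(\<xi> [^] k) [^] ?m = (\<xi> [^] ?m) [^] k"
      using \<xi>(1) by (simp only: R.nat_pow_pow mult.commute)
    ultimately show "x \<in> {x \<in> carrier R. x [^] ?m = \<one>}" using \<xi> by simp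
  next
    fix x assume "x \<in> {x \<in> carrier R. x [^] ?m = \<one>}"
    moreover have "\<xi> [^] k \<noteq> \<one>" if "0 < k" "k < ?m" for k
      using \<xi>(3)[of k] that nat_dvd_not_less by blast
    ultimately show "x \<in> {\<xi> [^] k |k::nat. k < ?m}"
      using roots_of_unity_powers[OF odd_order \<xi>(1,2), of x] by auto
  qed
  then show ?thesis by (simp add: teichmuller_def \<xi>_def)
qed

text \<open>The Teichmuller decomposition of such an \<open>x\<close> is (x, 0), and only its
  uniqueness has to be checked. Reduction modulo 2 forces the first part to be \<open>x\<close>;
  then 2b = 0, and a nonzero Teichmuller element \<open>b\<close> would be a unit, contradicting
  that 2 is nonzero.\<close>

lemma gr_frobenius_root_of_unity:
  assumes x: "x \<in> carrier R" "x [^] (2 ^ r - 1 :: nat) = \<one>"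
  shows "gr_frobenius R r s x = x [^] (2 ^ s :: nat)"
proof -
  let ?m = "2 ^ r - 1 :: nat"
  let ?T = "teichmuller R r"
  have m: "?m > 0" using odd_pos[OF odd_order] .
  have unique: "a = x \<and> b = \<zero>" if a: "a \<in> ?T" and b: "b \<in> ?T" and eq: "x = a \<oplus> of_Z4 R 2 \<otimes> b" for a b
  proof -
    have car: "a \<in> carrier R" "b \<in> carrier R" using a b by (auto simp: teichmuller_eq)
    have "\<theta> x = \<theta> a" unfolding eq using car by (simp add: hom_two)
    then have "a \<noteq> \<zero>" using hom_pow_one_nonzero[OF x m] by auto
    then have "a [^] ?m = \<one>" using a by (auto simp: teichmuller_eq)
    then have ax: "a = x"
      using eq_hom_imp_eq[OF car(1) _ x odd_order] \<open>\<theta> x = \<theta> a\<close> by simp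
    then have "x \<oplus> of_Z4 R 2 \<otimes> b = x \<oplus> \<zero>" using eq x by simp
    then have tb: "of_Z4 R 2 \<otimes> b = \<zero>" using x car by (simp only: R.add.l_cancel R.m_closed R.of_Z4_closed R.zero_closed)
    have "b = \<zero>"
    proof (rule ccontr)
      assume "b \<noteq> \<zero>"
      then have "b [^] ?m = \<one>" using b by (auto simp: teichmuller_eq)
      then have "b \<in> Units R" using hom_pow_one_nonzero[OF car(2) _ m] unitI[OF car(2)] by simp
      then have "of_Z4 R 2 \<otimes> b \<otimes> inv b = of_Z4 R 2" by (simp add: R.m_assoc car)
      with tb two \<open>b \<in> Units R\<close> show False by simp
    qed
    with ax show ?thesis by simp
  qed
  have T: "x \<in> ?T" "\<zero> \<in> ?T" using x by (auto simp: teichmuller_eq)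
  have "(THE (a, b). a \<in> ?T \<and> b \<in> ?T \<and> x = a \<oplus> of_Z4 R 2 \<otimes> b) = (x, \<zero>)"
  proof (rule the_equality)
    show "case (x, \<zero>) of (a, b) \<Rightarrow> a \<in> ?T \<and> b \<in> ?T \<and> x = a \<oplus> of_Z4 R 2 \<otimes> b"
      using T x(1) by simp
  next
    fix ab assume ab: "case ab of (a, b) \<Rightarrow> a \<in> ?T \<and> b \<in> ?T \<and> x = a \<oplus> of_Z4 R 2 \<otimes> b"
    obtain a b where [simp]: "ab = (a, b)" by (cases ab)
    have "a = x \<and> b = \<zero>" by (rule unique) (use ab in simp_all)
    then show "ab = (x, \<zero>)" by simp
  qed
  then show ?thesis using x by (simp add: gr_frobenius_def R.nat_pow_zero)
qed

lemma gr_trace_root_of_unity: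
  assumes x: "x \<in> carrier R" "x [^] (2 ^ r - 1 :: nat) = \<one>"
  shows "gr_trace R s r x = (\<Oplus>k\<in>{..<r div s}. x [^] (2 ^ (s * k) :: nat))"
proof -
  have "(gr_frobenius R r s ^^ k) x = x [^] (2 ^ (s * k) :: nat)" for k
  proof (induction k)
    case (Suc k)
    \<comment> \<open>Each iterate is again a root of unity of the same kind, so the Frobenius
      formula can be applied to it.\<close>
    have "(x [^] (2 ^ (s * k) :: nat)) [^] (2 ^ r - 1 :: nat) = (x [^] (2 ^ r - 1 :: nat)) [^] (2 ^ (s * k) :: nat)"
      using x(1) by (simp only: R.nat_pow_pow mult.commute)
    then have "gr_frobenius R r s (x [^] (2 ^ (s * k) :: nat)) = (x [^] (2 ^ (s * k) :: nat)) [^] (2 ^ s :: nat)"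
      using x by (intro gr_frobenius_root_of_unity) auto
    with Suc x show ?case by (simp add: R.nat_pow_pow power_add mult.commute)
  qed (use x in simp)
  then show ?thesis by (simp add: gr_trace_def)
qed

text \<open>The factor x - 1 may be cancelled because it is a unit: as \<open>n\<close> is odd,
  \<open>x\<close> and 1 already differ after reduction.\<close>

lemma sum_powers_root_of_unity:
  fixes n :: nat
  assumes x: "x \<in> carrier R" "x [^] n = \<one>" "x \<noteq> \<one>" and n: "odd n"
  shows "(\<Oplus>k\<in>{..<n}. x [^] k) = \<zero>"
proof -
  have "\<theta> x \<noteq> \<theta> \<one>" using eq_hom_imp_eq[OF x(1,2) R.one_closed R.nat_pow_one n] x(3) by blast
  then have "\<theta> (x \<ominus> \<one>) \<noteq> \<zero>\<^bsub>K\<^esub>" using x(1) by (simp add: R.minus_eq flip: K.minus_eq)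
  then have u: "x \<ominus> \<one> \<in> Units R" using x by (intro unitI) auto
  have c: "(\<Oplus>k\<in>{..<n}. x [^] k) \<in> carrier R" using x by auto
  have "(x \<ominus> \<one>) \<otimes> (\<Oplus>k\<in>{..<n}. x [^] k) = (x \<ominus> \<one>) \<otimes> \<zero>"
    using R.geometric_sum[OF x(1), of n] x by (simp add: R.r_right_minus_eq)
  with u c show ?thesis by (simp only: R.Units_l_cancel R.zero_closed)
qed

end

section \<open>Sums and roots of unity in a Galois subring\<close>

lemma (in ring) finsum_subring:
  assumes "subring S R" and "f \<in> A \<rightarrow> S"
  shows "finsum (R\<lparr>carrier := S\<rparr>) f A = finsum R f A"
proof -
  interpret S: ring "R\<lparr>carrier := S\<rparr>" by (rule subring_is_ring[OF assms(1)])
  have "S \<subseteq> carrier R" using subringE(1)[OF assms(1)] .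
  with assms(2) show ?thesis
  proof (induction A rule: infinite_finite_induct)
    case (insert a A)
    then show ?case
      by (subst finsum_insert, simp_all) (use insert in \<open>auto simp: Pi_def\<close>)
  qed (simp_all add: S.finsum_infinite)
qed

text \<open>The subring has its own element of order 2^s - 1, and its powers are all the roots of
  that equation even in the larger ring. This places the powers of \<open>\<beta>\<close> with
  exponents divisible by \<open>q\<close> in the copy of GR(4,4^l_p).\<close>

lemma galois_subring_contains_roots:
  fixes R :: "('a, 'm) ring_scheme" (structure)
  assumes red: "galois_reduction R K \<theta> r"
    and sub: "subring S R" and redS: "galois_reduction (R\<lparr>carrier := S\<rparr>) K' \<theta>' s"
    and x: "x \<in> carrier R" "x [^] (2 ^ s - 1 :: nat) = \<one>"
  shows "x \<in> S"
proof -
  interpret galois_reduction R K \<theta> r by (rule red)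
  interpret S: galois_reduction "R\<lparr>carrier := S\<rparr>" K' \<theta>' s by (rule redS)
  let ?m = "2 ^ s - 1 :: nat"
  have pow: "y [^]\<^bsub>R\<lparr>carrier := S\<rparr>\<^esub> (k::nat) = y [^] k" for y k
    using R.nat_pow_consistent[of y k S] by simp
  have "?m > 0" using odd_pos[OF S.odd_order] .
  then obtain \<xi> where "\<xi> \<in> S" "\<xi> [^] ?m = \<one>" "\<And>k. \<xi> [^] k = \<one> \<Longrightarrow> ?m dvd k"
    using S.unit_of_max_order S.R.unit_of_order_iff[of ?m] by (auto simp: pow)
  moreover from this have "\<xi> \<in> carrier R" using subringE(1)[OF sub] by auto
  ultimately have "\<exists>k<?m. x = \<xi> [^] k"
    by (intro roots_of_unity_powers[OF S.odd_order _ _ _ x]) (use nat_dvd_not_less in blast)+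
  then obtain k :: nat where "x = \<xi> [^] k" by blast
  with S.R.nat_pow_closed[of \<xi> k] \<open>\<xi> \<in> S\<close> show ?thesis by (simp add: pow)
qed

lemma (in galois_reduction) eval_class_poly:
  assumes x: "x \<in> carrier R"
  shows "eval_Z4 R (class_poly p q g h k) x = (\<Oplus>u\<in>cyc_class p q g h k. x [^] u)"
proof -
  let ?A = "residue_ring 4" and ?C = "cyc_class p q g h k"
  have A: "cring ?A" using residues.cring[of 4] by (simp add: residues_def)
  have hom4: "of_Z4 R \<in> ring_hom ?A R"
    by (intro ring_hom_memI)
      (auto simp: residue_ring_def R.of_Z4_1 cong_def simp flip: R.of_Z4_add R.of_Z4_mult intro!: of_Z4_eqI)
  interpret U: UP_pre_univ_prop ?A R "of_Z4 R" "UP ?A"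
    by (rule UP_pre_univ_propI[OF A R.is_cring hom4])
  let ?ev = "UnivPoly.eval ?A R (of_Z4 R) x"
  interpret ev: ring_hom_cring "UP ?A" R ?ev
    by (intro ring_hom_cring.intro ring_hom_cring_axioms.intro U.P.is_cring R.is_cring U.eval_ring_hom x)
  have one: "1 \<in> carrier ?A" by (simp add: residue_ring_def)
  have "eval_Z4 R (class_poly p q g h k) x = (\<Oplus>u\<in>?C. (?ev \<circ> monom (UP ?A) 1) u)"
    unfolding eval_Z4_def class_poly_def using one by (subst ev.hom_finsum) (auto simp: o_def)
  also have "\<dots> = (\<Oplus>u\<in>?C. x [^] u)"
    using U.eval_monom[OF one x] x by (intro R.finsum_cong') (auto simp: R.of_Z4_1)
  finally show ?thesis .
qed

section \<open>Generalized cyclotomic classes\<close>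

lemma ord_mult_coprime:
  fixes m n a :: nat
  assumes "coprime m n"
  shows "ord (m * n) a = lcm (ord m a) (ord n a)"
proof -
  have "ord (m * n) a dvd d \<longleftrightarrow> lcm (ord m a) (ord n a) dvd d" for d
  proof -
    have "[a ^ d = 1] (mod m * n) \<longleftrightarrow> [a ^ d = 1] (mod m) \<and> [a ^ d = 1] (mod n)"
      using assms coprime_cong_mult_nat cong_modulus_mult_nat by (metis mult.commute)
    then show ?thesis by (simp only: ord_divides lcm_least_iff)
  qed
  then show ?thesis by (metis dvd_antisym dvd_refl)
qed

text \<open>In the cyclic group generated by \<open>a\<close>, the powers of \<open>a\<close> below
  the index of the subgroup generated by \<open>c\<close> represent the cosets of that
  subgroup.\<close>

lemma bij_betw_power_cosets:
  fixes n a c t :: nat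
  assumes a: "coprime n a" and n: "n > 0" and c: "[c = a ^ t] (mod n)"
  defines "m \<equiv> ord n c"
  shows "bij_betw (\<lambda>(i, k). (a ^ i * c ^ k) mod n) ({..<ord n a div m} \<times> {..<m})
    ((\<lambda>s. a ^ s mod n) ` {..<ord n a})"
proof -
  let ?o = "ord n a"
  have cc: "coprime n c" using a c by (simp add: coprime_cong_cong_right[OF c])
  have o: "?o > 0" and m0: "m > 0" using a cc by (simp_all add: m_def)
  have ct: "[c ^ k = a ^ (t * k)] (mod n)" for k
    using cong_pow[OF c, of k] by (simp add: power_mult)
  have "[c ^ ?o = 1] (mod n)"
    using ct[of ?o] cong_pow[OF ord[of a n], of t] by (auto simp: power_mult[symmetric] mult.commute intro: cong_trans)
  then have dv: "m dvd ?o" unfolding m_def by (simp only: ord_divides)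
  have card1: "card ((\<lambda>s. a ^ s mod n) ` {..<?o}) = ?o"
    by (subst card_image)
      (auto intro!: inj_onI dest: cong_less_modulus_unique_nat simp: order_divides_expdiff[OF a] simp flip: cong_def)
  have inj: "inj_on (\<lambda>(i, k). (a ^ i * c ^ k) mod n) ({..<?o div m} \<times> {..<m})"
  proof (rule inj_onI, clarsimp simp flip: cong_def)
    fix i k i' k'
    assume i: "i < ?o div m" "i' < ?o div m" and k: "k < m" "k' < m"
      and eq: "[a ^ i * c ^ k = a ^ i' * c ^ k'] (mod n)"
    have c1: "[c ^ (k * m) = 1] (mod n)" for k
      using cong_pow[OF ord[of c n], of k] by (simp add: m_def power_mult[symmetric] mult.commute)
    \<comment> \<open>Raising to the power \<open>m\<close>, the order of \<open>c\<close>, removes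
      the factor from the subgroup; the remaining exponents i m lie below the order of
      \<open>a\<close>, so they determine i.\<close>
    have e: "[a ^ (i * m) = (a ^ i * c ^ k) ^ m] (mod n)" for i k
      using cong_mult[OF cong_refl[of "a ^ (i * m)"] cong_sym[OF c1[of k]]]
      by (simp add: power_mult_distrib power_mult)
    have "[a ^ (i * m) = a ^ (i' * m)] (mod n)"
      using e[of i k] e[of i' k'] cong_pow[OF eq, of m] by (meson cong_trans cong_sym)
    then have "[i * m = i' * m] (mod ?o)" by (simp add: order_divides_expdiff[OF a])
    moreover have "i * m < ?o" "i' * m < ?o"
      using i m0 mult_less_mono1[of _ "?o div m" m] dvd_div_mult_self[OF dv] by metis+
    ultimately have ii: "i = i'" using cong_less_modulus_unique_nat m0 by fastforce
    have "coprime (a ^ i) n" using a by (simp add: coprime_commute)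
    then have "[c ^ k = c ^ k'] (mod n)" using eq ii by (simp add: cong_mult_lcancel_nat)
    then have "[k = k'] (mod m)" by (simp add: order_divides_expdiff[OF cc] m_def)
    then show "i = i' \<and> k = k'" using ii k cong_less_modulus_unique_nat by blast
  qed
  have sub: "(\<lambda>(i, k). (a ^ i * c ^ k) mod n) ` ({..<?o div m} \<times> {..<m})
      \<subseteq> (\<lambda>s. a ^ s mod n) ` {..<?o}"
  proof clarsimp
    fix i k
    have "[a ^ i * c ^ k = a ^ (i + t * k)] (mod n)"
      unfolding power_add by (intro cong_mult cong_refl ct)
    also have "[a ^ (i + t * k) = a ^ ((i + t * k) mod ?o)] (mod n)"
      by (simp add: order_divides_expdiff[OF a])
    finally have "(a ^ i * c ^ k) mod n = a ^ ((i + t * k) mod ?o) mod n" by (simp add: cong_def)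
    with o show "(a ^ i * c ^ k) mod n \<in> (\<lambda>s. a ^ s mod n) ` {..<?o}" by auto
  qed
  have "card ((\<lambda>(i, k). (a ^ i * c ^ k) mod n) ` ({..<?o div m} \<times> {..<m})) = ?o"
    using dv by (simp add: card_image[OF inj])
  with sub card1 show ?thesis
    unfolding bij_betw_def using inj by (intro conjI card_subset_eq) auto
qed

text \<open>\<open>G\<close> and \<open>H\<close> are natural representatives of g and h modulo pq,
  chosen so that \<open>ord\<close> and \<open>residue_primroot\<close> apply to them
  directly.\<close>

locale cyclotomic_classes =
  fixes p q G H e :: nat
  assumes p: "prime p" and q: "prime q" and pq: "p \<noteq> q"
    and gcd4: "gcd (p - 1) (q - 1) = 4"
    and e_def: "e = (p - 1) * (q - 1) div 4"
    and Gp: "residue_primroot p G" and Gq: "residue_primroot q G"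
    and Hp: "[H = G] (mod p)" and Hq: "[H = 1] (mod q)"
begin

lemma coprime_pq: "coprime p q"
  using p q pq by (simp add: primes_coprime)

lemma four_dvd: "4 dvd p - 1" "4 dvd q - 1"
  by (metis gcd4 gcd_dvd1, metis gcd4 gcd_dvd2)

lemma four_e: "4 * e = (p - 1) * (q - 1)"
  using four_dvd(1) by (simp add: e_def)

lemma pos: "p > 1" "q > 1" "p * q > 1" "e > 0"
proof -
  show "p > 1" "q > 1" by (rule prime_gt_1_nat, fact p, rule prime_gt_1_nat, fact q)
  then show "p * q > 1" by (metis less_1_mult)
  have "(p - 1) * (q - 1) > 0" using \<open>p > 1\<close> \<open>q > 1\<close> by simp
  then show "e > 0" using four_e by (metis mult_0_right gr0I less_irrefl)
qed

lemma e_lcm: "e = lcm (p - 1) (q - 1)"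
  using prod_gcd_lcm_nat[of "p - 1" "q - 1"] unfolding gcd4 e_def by simp

lemma ord_p: "ord p G = p - 1" and ord_q: "ord q G = q - 1"
  using Gp Gq p q by (simp_all add: residue_primroot_def totient_prime)

lemma coprime_G: "coprime p G" "coprime q G" "coprime (p * q) G"
  using Gp Gq by (simp_all add: residue_primroot_def)

lemma ord_pq: "ord (p * q) G = e"
  using ord_mult_coprime[OF coprime_pq] by (simp add: ord_p ord_q e_lcm)

lemma cong_pow_p: "[G ^ i = G ^ j] (mod p) \<longleftrightarrow> [i = j] (mod p - 1)"
  and cong_pow_q: "[G ^ i = G ^ j] (mod q) \<longleftrightarrow> [i = j] (mod q - 1)"
  and cong_pow_pq: "[G ^ i = G ^ j] (mod p * q) \<longleftrightarrow> [i = j] (mod e)"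
  using order_divides_expdiff[OF coprime_G(1)] order_divides_expdiff[OF coprime_G(2)]
    order_divides_expdiff[OF coprime_G(3)] by (simp_all add: ord_p ord_q ord_pq)

lemma coprime_H: "coprime p H" "coprime q H" "coprime (p * q) H"
  using coprime_G coprime_cong_cong_right[OF Hp] coprime_cong_cong_right[OF Hq] by simp_all

lemma coprime_class: "coprime (G ^ s * H ^ i) (p * q)"
  using coprime_G coprime_H by (simp add: coprime_commute)

lemma class_not_dvd:
  assumes "[u = G ^ s * H ^ i] (mod p * q)"
  shows "\<not> p dvd u" "\<not> q dvd u"
proof -
  have "coprime u (p * q)" using coprime_cong_cong_left[OF assms] coprime_class by blast
  then show "\<not> p dvd u" "\<not> q dvd u"
    using pos by (metis coprime_common_divisor dvd_triv_left dvd_triv_right nat_dvd_1_iff_1 nat_neq_iff)+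
qed

lemma class_mod_p: "[G ^ s * H ^ i = G ^ (s + i)] (mod p)"
  unfolding power_add by (intro cong_mult cong_refl cong_pow Hp)

lemma class_mod_q: "[G ^ s * H ^ i = G ^ s] (mod q)"
  using cong_mult[OF cong_refl[of "G ^ s"] cong_pow[OF Hq, of i]] by simp

text \<open>Modulo \<open>q\<close> the element \<open>H\<close> disappears, modulo \<open>p\<close>
  it counts as one more \<open>G\<close>. Since 4 divides both p - 1 and q - 1, comparing the two
  congruences isolates i and j modulo 4. The exponents are unbounded so that the lemma also covers
  \<open>H ^ 4\<close> and powers of elements of a class.\<close>

lemma class_eqD:
  assumes "[G ^ s * H ^ i = G ^ t * H ^ j] (mod p * q)"
  shows "[s = t] (mod q - 1)" "[s + i = t + j] (mod p - 1)" "[i = j] (mod 4)"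
proof -
  have "[G ^ s * H ^ i = G ^ t * H ^ j] (mod p)" "[G ^ s * H ^ i = G ^ t * H ^ j] (mod q)"
    using assms by (metis cong_modulus_mult_nat mult.commute)+
  then have "[G ^ (s + i) = G ^ (t + j)] (mod p)" "[G ^ s = G ^ t] (mod q)"
    using class_mod_p class_mod_q by (meson cong_trans cong_sym)+
  then show 1: "[s = t] (mod q - 1)" "[s + i = t + j] (mod p - 1)"
    by (simp_all add: cong_pow_p cong_pow_q)
  then have "[s = t] (mod 4)" "[s + i = t + j] (mod 4)"
    using four_dvd by (auto intro: cong_dvd_modulus_nat)
  then have "[t + i = t + j] (mod 4)" by (metis cong_add_rcancel_nat cong_sym cong_trans)
  then show "[i = j] (mod 4)" by (simp add: cong_add_lcancel_nat)
qed

lemma class_eq_iff: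
  assumes "i < 4" "j < 4"
  shows "[G ^ s * H ^ i = G ^ t * H ^ j] (mod p * q) \<longleftrightarrow> i = j \<and> [s = t] (mod e)"
proof
  assume A: "[G ^ s * H ^ i = G ^ t * H ^ j] (mod p * q)"
  have "i = j" using class_eqD(3)[OF A] assms cong_less_modulus_unique_nat by blast
  moreover from this have "[G ^ s * H ^ i = G ^ t * H ^ i] (mod p * q)" using A by simp
  moreover have "coprime (H ^ i) (p * q)" using coprime_H by (simp add: coprime_commute)
  ultimately show "i = j \<and> [s = t] (mod e)"
    by (simp add: cong_mult_rcancel_nat cong_pow_pq)
next
  assume "i = j \<and> [s = t] (mod e)"
  then show "[G ^ s * H ^ i = G ^ t * H ^ j] (mod p * q)"
    by (auto intro!: cong_mult simp: cong_pow_pq)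
qed

text \<open>Surjectivity is a count: the 4e distinct residues are units, and there are (p - 1)(q -
  1) = 4e units.\<close>

lemma bij_betw_units:
  "bij_betw (\<lambda>(s, i). (G ^ s * H ^ i) mod (p * q)) ({..<e} \<times> {..<4}) {v. v < p * q \<and> coprime v (p * q)}"
proof -
  let ?f = "\<lambda>(s, i). (G ^ s * H ^ i) mod (p * q)" and ?U = "{v. v < p * q \<and> coprime v (p * q)}"
  have inj: "inj_on ?f ({..<e} \<times> {..<4})"
    by (rule inj_onI) (auto simp: class_eq_iff simp flip: cong_def dest: cong_less_modulus_unique_nat)
  have sub: "?f ` ({..<e} \<times> {..<4}) \<subseteq> ?U"
  proof clarify
    fix s i
    show "(G ^ s * H ^ i) mod (p * q) < p * q \<and> coprime ((G ^ s * H ^ i) mod (p * q)) (p * q)"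
      using pos coprime_class[of s i] by (simp del: coprime_mult_right_iff coprime_mult_left_iff)
  qed
  have "?U = totatives (p * q)"
    using pos by (auto simp: totatives_def coprime_commute intro: le_neq_implies_less gr0I)
  then have "card ?U = (p - 1) * (q - 1)"
    using totient_mult_coprime[OF coprime_pq] p q by (simp add: totient_def[symmetric] totient_prime)
  then have "card (?f ` ({..<e} \<times> {..<4})) = card ?U"
    using four_e by (simp add: card_image[OF inj])
  then show ?thesis
    unfolding bij_betw_def using inj sub by (intro conjI card_subset_eq) auto
qed

lemma unit_classE:
  assumes "coprime v (p * q)"
  obtains s i where "s < e" "i < 4" "[v = G ^ s * H ^ i] (mod p * q)"
proof -
  have "v mod (p * q) \<in> {v. v < p * q \<and> coprime v (p * q)}" 
    using assms pos by (simp del: coprime_mult_right_iff)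
  then have "v mod (p * q) \<in> (\<lambda>(s, i). (G ^ s * H ^ i) mod (p * q)) ` ({..<e} \<times> {..<4})"
    unfolding bij_betw_imp_surj_on[OF bij_betw_units] .
  then obtain s i where "s < e" "i < 4" "v mod (p * q) = (G ^ s * H ^ i) mod (p * q)"
    by auto
  with that show ?thesis by (simp add: cong_def)
qed

text \<open>The unit \<open>H ^ 4\<close> lies in some class, and the invariant modulo 4 leaves only
  class 0. This is what makes the class indices cyclic.\<close>

lemma H_pow_4: "\<exists>t. [H ^ 4 = G ^ t] (mod p * q)"
proof -
  have "coprime (H ^ 4) (p * q)" using coprime_H by (simp add: coprime_commute)
  then obtain t i where t: "i < 4" "[H ^ 4 = G ^ t * H ^ i] (mod p * q)" using unit_classE by blast
  then have "[G ^ 0 * H ^ 4 = G ^ t * H ^ i] (mod p * q)" by simp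
  from class_eqD(3)[OF this] t(1) have "i = 0" by (auto simp: cong_def)
  with t show ?thesis by auto
qed

text \<open>The l-th power of an element of class 2 has class index 2l modulo 4, while 1 has index
  0. This makes the degree even, as the trace down to GR(4,4^2) requires.\<close>

lemma even_ord_of_class_2:
  assumes "[2 = G ^ t * H ^ 2] (mod p * q)" and "[2 ^ l = (1::nat)] (mod p * q)"
  shows "even l"
proof -
  have "[(G ^ t * H ^ 2) ^ l = 2 ^ l] (mod p * q)" by (intro cong_pow cong_sym[OF assms(1)])
  then have "[G ^ (t * l) * H ^ (2 * l) = G ^ 0 * H ^ 0] (mod p * q)"
    using assms(2) by (simp add: power_mult_distrib power_mult cong_trans)
  from class_eqD(3)[OF this] show ?thesis unfolding cong_def by presburger
qed

end

section \<open>Sums over cyclotomic classes\<close>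

lemma (in abelian_monoid) finsum_lessThan_add:
  assumes "f \<in> UNIV \<rightarrow> carrier G"
  shows "(\<Oplus>i\<in>{..<m + n::nat}. f i) = (\<Oplus>i\<in>{..<m}. f i) \<oplus> (\<Oplus>i\<in>{..<n}. f (m + i))"
proof (induction n)
  case (Suc n)
  have [simp]: "f i \<in> carrier G" for i using assms by auto
  show ?case using Suc by (simp add: lessThan_Suc a_lcomm)
qed (use assms in \<open>auto simp: Pi_def\<close>)

lemma (in abelian_monoid) finsum_periodic_shift:
  assumes f: "f \<in> UNIV \<rightarrow> carrier G" and per: "\<And>i. f (i + n) = f i"
  shows "(\<Oplus>i\<in>{..<n::nat}. f (i + a)) = (\<Oplus>i\<in>{..<n}. f i)"
proof (induction a)
  case (Suc a)
  have fa: "(\<lambda>i. f (i + a)) \<in> UNIV \<rightarrow> carrier G" using f by auto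
  have [simp]: "f i \<in> carrier G" for i using f by auto
  show ?case
  proof (cases n)
    case (Suc m)
    have "(\<Oplus>i\<in>{..<n}. f (i + Suc a)) = f (n + a) \<oplus> (\<Oplus>i\<in>{..<m}. f (i + Suc a))"
      by (simp add: Suc lessThan_Suc)
    also have "\<dots> = f a \<oplus> (\<Oplus>i\<in>{..<m}. f (Suc i + a))"
      using per[of a] by (simp add: add.commute)
    also have "\<dots> = (\<Oplus>i\<in>{..<n}. f (i + a))"
      using finsum_lessThan_add[OF fa, of 1 m] by (simp add: Suc lessThan_Suc)
    finally show ?thesis using Suc.IH by simp
  qed simp
qed simp

lemma (in ring) finsum_periods:
  assumes f: "f \<in> UNIV \<rightarrow> carrier R" and per: "\<And>i. f (i + n) = f i"
  shows "(\<Oplus>i\<in>{..<b * n::nat}. f i) = of_Z4 R (int b) \<otimes> (\<Oplus>i\<in>{..<n}. f i)"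
proof (induction b)
  case 0
  show ?case using f by (simp add: of_Z4_0 Pi_def)
next
  case (Suc b)
  have [simp]: "f i \<in> carrier R" for i using f by auto
  have per': "f (i + b * n) = f i" for i
  proof (induction b)
    case (Suc b)
    then show ?case using per[of "i + b * n"] by (simp add: algebra_simps)
  qed simp
  have "(\<Oplus>i\<in>{..<b * n + n}. f i) = (\<Oplus>i\<in>{..<b * n}. f i) \<oplus> (\<Oplus>i\<in>{..<n}. f (i + b * n))"
    using finsum_lessThan_add[OF f, of "b * n" n] by (simp add: add.commute)
  then show ?case
    using Suc of_Z4_add[of "int b" 1] by (simp add: per' of_Z4_1 l_distr add.commute)
qed

lemma (in abelian_monoid) finsum_cartesian:
  assumes fin: "finite A" "finite B" and f: "\<And>i k. i \<in> A \<Longrightarrow> k \<in> B \<Longrightarrow> f i k \<in> carrier G"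
  shows "(\<Oplus>i\<in>A. \<Oplus>k\<in>B. f i k) = (\<Oplus>x\<in>A \<times> B. f (fst x) (snd x))"
  using fin(1) f
proof (induction A rule: finite_induct)
  case (insert a A)
  have split: "insert a A \<times> B = Pair a ` B \<union> A \<times> B" by auto
  have "(\<Oplus>x\<in>Pair a ` B. f (fst x) (snd x)) = (\<Oplus>k\<in>B. f a k)"
    using insert.prems by (subst finsum_reindex) (auto simp: inj_on_def)
  moreover have "(\<Oplus>x\<in>insert a A \<times> B. f (fst x) (snd x)) =
      (\<Oplus>x\<in>Pair a ` B. f (fst x) (snd x)) \<oplus> (\<Oplus>x\<in>A \<times> B. f (fst x) (snd x))"
    unfolding split using insert fin(2) by (intro finsum_Un_disjoint) auto
  moreover have "(\<Oplus>i\<in>insert a A. \<Oplus>k\<in>B. f i k) = (\<Oplus>k\<in>B. f a k) \<oplus> (\<Oplus>i\<in>A. \<Oplus>k\<in>B. f i k)"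
    using insert by (intro finsum_insert) auto
  ultimately show ?case using insert by simp
qed simp

text \<open>With \<open>c\<close> a power of 2, the inner sum is a trace and the outer one runs over
  coset representatives; this is the collapse of the sums of traces.\<close>

lemma (in abelian_monoid) finsum_power_cosets:
  fixes n a c t :: nat
  assumes a: "coprime n a" and n: "n > 0" and c: "[c = a ^ t] (mod n)"
    and f: "f \<in> UNIV \<rightarrow> carrier G" and cong: "\<And>x y. [x = y] (mod n) \<Longrightarrow> f x = f y"
  shows "(\<Oplus>i\<in>{..<ord n a div ord n c}. \<Oplus>k\<in>{..<ord n c}. f (a ^ i * c ^ k)) =
    (\<Oplus>s\<in>{..<ord n a}. f (a ^ s))"
proof -
  let ?A = "{..<ord n a div ord n c} \<times> {..<ord n c}"
  let ?h = "\<lambda>(i, k). (a ^ i * c ^ k) mod n"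
  note b = bij_betw_power_cosets[OF a n c]
  have fm: "f (x mod n) = f x" for x by (rule cong) (simp add: cong_def)
  have [simp]: "f x \<in> carrier G" for x using f by auto
  have "(\<Oplus>i\<in>{..<ord n a div ord n c}. \<Oplus>k\<in>{..<ord n c}. f (a ^ i * c ^ k)) =
      (\<Oplus>x\<in>?A. f (a ^ fst x * c ^ snd x))"
    by (rule finsum_cartesian) auto
  also have "\<dots> = (\<Oplus>x\<in>?A. f (?h x))"
    by (intro finsum_cong') (auto simp: fm split_beta)
  also have "\<dots> = (\<Oplus>y\<in>?h ` ?A. f y)"
    using b by (intro finsum_reindex[symmetric]) (auto simp: bij_betw_def)
  also have "?h ` ?A = (\<lambda>s. a ^ s mod n) ` {..<ord n a}"
    using b by (rule bij_betw_imp_surj_on)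
  also have "(\<Oplus>y\<in>(\<lambda>s. a ^ s mod n) ` {..<ord n a}. f y) = (\<Oplus>s\<in>{..<ord n a}. f (a ^ s mod n))"
  proof (intro finsum_reindex inj_onI)
    fix x y assume "x \<in> {..<ord n a}" "y \<in> {..<ord n a}" "a ^ x mod n = a ^ y mod n"
    then show "x = y"
      using order_divides_expdiff[OF a, of x y] by (auto simp: cong_def)
  qed auto
  finally show ?thesis by (simp add: fm)
qed

section \<open>Powers of beta summed over the classes\<close>

locale cyclotomic_galois = cyclotomic_classes p q G H e + galois_reduction R K \<theta> r
  for p q G H e and R (structure) and K (structure) and \<theta> r +
  fixes \<beta>
  assumes \<beta>: "\<beta> \<in> carrier R" "\<beta> [^] (p * q) = \<one>"
    and ord_\<beta>: "\<And>k. \<beta> [^] (k::nat) = \<one> \<Longrightarrow> p * q dvd k"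
    and p8: "[p = 5] (mod 8)" and q8: "[q = 5] (mod 8)"
begin

definition F :: "nat \<Rightarrow> 'a" where "F z = \<beta> [^] z"

text \<open>This is D_k(beta^u). Summing over exponents \<open>s\<close> instead of residues lets
  shifts in \<open>s\<close> and \<open>k\<close> express multiplication of \<open>u\<close> by a
  unit.\<close>

definition class_sum :: "nat \<Rightarrow> nat \<Rightarrow> 'a" where "class_sum u k = (\<Oplus>s\<in>{..<e}. F (u * (G ^ s * H ^ k)))"

definition p_sum :: "nat \<Rightarrow> 'a" where "p_sum u = (\<Oplus>s\<in>{..<p - 1}. F (u * G ^ s * q))"

lemma F_closed [simp]: "F z \<in> carrier R"
  using \<beta> by (simp add: F_def)

lemma F_add: "F (x + y) = F x \<otimes> F y"
  using \<beta> by (simp add: F_def R.nat_pow_mult)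

lemma F_pow: "F x [^] (k::nat) = F (x * k)"
  using \<beta> by (simp add: F_def R.nat_pow_pow)

lemma F_eq_1_iff: "F z = \<one> \<longleftrightarrow> p * q dvd z"
proof
  assume "p * q dvd z"
  then obtain k where "z = p * q * k" ..
  moreover have "F (p * q) = \<one>" using \<beta> by (simp add: F_def)
  ultimately show "F z = \<one>" using F_pow[of "p * q" k] by simp
qed (use ord_\<beta> in \<open>simp add: F_def\<close>)

lemma F_cong:
  assumes "[x = y] (mod p * q)"
  shows "F x = F y"
proof -
  have "F (z mod (p * q)) = F z" for z
    using F_add[of "p * q * (z div (p * q))" "z mod (p * q)"] F_eq_1_iff[of "p * q * (z div (p * q))"]
    by simp
  then show ?thesis using assms unfolding cong_def by metis
qed

lemma class_sum_closed [simp]: "class_sum u k \<in> carrier R"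
  by (auto simp: class_sum_def)

lemma p_sum_closed [simp]: "p_sum u \<in> carrier R"
  by (auto simp: p_sum_def)

lemma odd_pq: "odd p" "odd q" "odd ((p - 1) div 4)" "odd ((q - 1) div 4)"
proof -
  have "\<exists>k. n = 8 * k + 5" if "[n = 5] (mod 8)" for n :: nat
  proof -
    have "n mod 8 = 5" using that by (simp add: cong_def)
    then show ?thesis by presburger
  qed
  then obtain k j where "p = 8 * k + 5" "q = 8 * j + 5" using p8 q8 by metis
  then show "odd p" "odd q" "odd ((p - 1) div 4)" "odd ((q - 1) div 4)" by auto
qed

lemma sum_F_multiples:
  assumes "prime n" "odd n" "F u [^] n = \<one>" "F u \<noteq> \<one>"
  shows "(\<Oplus>k\<in>{1..<n}. F (u * k)) = of_Z4 R (- 1)"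
proof -
  have n: "n > 0" by (rule prime_gt_0_nat) (fact assms(1))
  have "(\<Oplus>k\<in>{..<n}. F u [^] k) = \<zero>"
    using assms by (intro sum_powers_root_of_unity) auto
  moreover have "{..<n} = insert 0 {1..<n}" using n by auto
  moreover have "F 0 = \<one>" by (simp add: F_eq_1_iff)
  ultimately have "\<one> \<oplus> (\<Oplus>k\<in>{1..<n}. F (u * k)) = \<zero>"
    by (simp add: F_pow)
  moreover have "of_Z4 R (- 1) = \<ominus> \<one>" by (simp add: of_Z4_def R.add.int_pow_neg)
  ultimately show ?thesis
    using R.minus_equality[of "\<Oplus>k\<in>{1..<n}. F (u * k)" \<one>] by (simp add: R.a_comm)
qed

lemma sum_F_primroot:
  assumes "prime n" "odd n" "F u [^] n = \<one>" "F u \<noteq> \<one>" "residue_primroot n G"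
  shows "(\<Oplus>s\<in>{..<n - 1}. F (u * G ^ s)) = of_Z4 R (- 1)"
proof -
  have n: "n > 1" by (rule prime_gt_1_nat) (fact assms(1))
  have cong: "F (u * (x mod n)) = F (u * x)" for x
  proof -
    have "F (u * (x div n * n + x mod n)) = F (u * n * (x div n)) \<otimes> F (u * (x mod n))"
      by (simp only: distrib_left F_add ac_simps) (simp add: R.m_comm)
    moreover have "F (u * n * (x div n)) = \<one>"
      using assms(3) F_pow[of "u * n" "x div n"] by (simp add: F_pow)
    ultimately show ?thesis by (simp only: div_mult_mod_eq F_closed R.l_one)
  qed
  have b: "bij_betw (\<lambda>i. G ^ i mod n) {..<n - 1} {1..<n}"
  proof -
    have "totatives n = {1..<n}" unfolding totatives_prime[OF assms(1)] by auto
    with residue_primroot_is_generator[OF n assms(5)] totient_prime[OF assms(1)]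
    show ?thesis by (simp only:)
  qed
  have "(\<Oplus>k\<in>{1..<n}. F (u * k)) = (\<Oplus>k\<in>(\<lambda>i. G ^ i mod n) ` {..<n - 1}. F (u * k))"
    using b by (simp add: bij_betw_def)
  also have "\<dots> = (\<Oplus>s\<in>{..<n - 1}. F (u * (G ^ s mod n)))"
    using b by (intro R.finsum_reindex) (auto simp: bij_betw_def)
  finally show ?thesis using sum_F_multiples[OF assms(1-4)] by (simp add: cong)
qed

text \<open>If \<open>p\<close> divides \<open>u\<close>, all p - 1 terms are 1, and p - 1 is 0
  modulo 4. Otherwise the terms run over all p-th roots of unity other than 1.\<close>

lemma p_sum_eq: "p_sum u = of_Z4 R (if p dvd u then 0 else - 1)"
proof (cases "p dvd u")
  case True
  then have "F (u * G ^ s * q) = \<one>" for s by (auto simp: F_eq_1_iff)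
  \<comment> \<open>A constant sequence has period 1; \<open>finsum_periods\<close> is used here
    just to count its terms.\<close>
  then have "p_sum u = of_Z4 R (int (p - 1)) \<otimes> (\<Oplus>i\<in>{..<1::nat}. \<one>)"
    using R.finsum_periods[of "\<lambda>_. \<one>" 1 "p - 1"] by (simp add: p_sum_def)
  also have "\<dots> = of_Z4 R (int (p - 1))" by (simp add: lessThan_Suc)
  also have "\<dots> = of_Z4 R 0"
    using four_dvd(1) by (intro of_Z4_eqI) (auto simp: cong_0_iff)
  finally show ?thesis using True by simp
next
  case False
  have "p_sum u = (\<Oplus>s\<in>{..<p - 1}. F (u * q * G ^ s))"
    by (simp add: p_sum_def mult.assoc mult.commute[of _ q])
  also have "\<dots> = of_Z4 R (- 1)"
  proof (rule sum_F_primroot[OF p odd_pq(1) _ _ Gp])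
    show "F (u * q) [^] p = \<one>" by (simp add: F_pow F_eq_1_iff mult.assoc mult.commute[of _ p])
    show "F (u * q) \<noteq> \<one>" using False pos by (simp add: F_eq_1_iff)
  qed
  finally show ?thesis using False by simp
qed

text \<open>The power beta^u is a q-th root of unity, so exponents matter only modulo
  \<open>q\<close>, where \<open>H\<close> is 1. The sum then runs (p - 1)/4 times through the q - 1
  powers of the primitive root.\<close>

lemma class_sum_P:
  assumes "p dvd u" "\<not> q dvd u"
  shows "class_sum u k = of_Z4 R (- int ((p - 1) div 4))"
proof -
  have cong: "F (u * x) = F (u * y)" if "[x = y] (mod q)" for x y
  proof (rule F_cong)
    obtain v where v: "u = p * v" using assms(1) ..
    have "[v * (p * x) = v * (p * y)] (mod p * q)"
      by (intro cong_mult cong_refl cong_cmult_leftI that)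
    then show "[u * x = u * y] (mod p * q)" by (simp only: v ac_simps)
  qed
  have "class_sum u k = (\<Oplus>s\<in>{..<(p - 1) div 4 * (q - 1)}. F (u * G ^ s))"
  proof -
    have "e = (p - 1) div 4 * (q - 1)" using four_dvd(1) by (auto simp: e_def)
    moreover have "class_sum u k = (\<Oplus>s\<in>{..<e}. F (u * G ^ s))"
      unfolding class_sum_def by (simp only: cong[OF class_mod_q])
    ultimately show ?thesis by (simp only:)
  qed
  also have "\<dots> = of_Z4 R (int ((p - 1) div 4)) \<otimes> (\<Oplus>s\<in>{..<q - 1}. F (u * G ^ s))"
    by (intro R.finsum_periods cong) (simp_all add: cong_pow_q, simp add: cong_def)
  also have "(\<Oplus>s\<in>{..<q - 1}. F (u * G ^ s)) = of_Z4 R (- 1)"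
  proof (rule sum_F_primroot[OF q odd_pq(2) _ _ Gq])
    show "F u [^] q = \<one>" using assms by (simp add: F_pow F_eq_1_iff mult_dvd_mono)
    show "F u \<noteq> \<one>" using assms by (auto simp: F_eq_1_iff elim: dvd_mult_right)
  qed
  finally show ?thesis by (simp flip: R.of_Z4_mult)
qed

text \<open>Now exponents matter modulo \<open>p\<close>, where \<open>H\<close> agrees with
  \<open>G\<close>. So \<open>k\<close> only shifts \<open>s\<close>, which does not change a sum
  over full periods.\<close>

lemma class_sum_Q:
  assumes "q dvd u" "\<not> p dvd u"
  shows "class_sum u k = of_Z4 R (- int ((q - 1) div 4))"
proof -
  have cong: "F (u * x) = F (u * y)" if "[x = y] (mod p)" for x y
  proof (rule F_cong)
    obtain v where v: "u = q * v" using assms(1) ..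
    have "[v * (q * x) = v * (q * y)] (mod q * p)"
      by (intro cong_mult cong_refl cong_cmult_leftI that)
    then show "[u * x = u * y] (mod p * q)" by (simp only: v ac_simps)
  qed
  have "class_sum u k = (\<Oplus>s\<in>{..<(q - 1) div 4 * (p - 1)}. F (u * G ^ (s + k)))"
  proof -
    have "e = (q - 1) div 4 * (p - 1)" using four_dvd(2) by (auto simp: e_def)
    moreover have "class_sum u k = (\<Oplus>s\<in>{..<e}. F (u * G ^ (s + k)))"
      unfolding class_sum_def by (simp only: cong[OF class_mod_p])
    ultimately show ?thesis by (simp only:)
  qed
  also have "\<dots> = of_Z4 R (int ((q - 1) div 4)) \<otimes> (\<Oplus>s\<in>{..<p - 1}. F (u * G ^ (s + k)))"
    by (intro R.finsum_periods cong) (simp_all add: cong_pow_p, simp add: cong_def, metis add.assoc add.commute mod_add_self2)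
  also have "(\<Oplus>s\<in>{..<p - 1}. F (u * G ^ (s + k))) = (\<Oplus>s\<in>{..<p - 1}. F (u * G ^ s))"
    by (intro R.finsum_periodic_shift[of "\<lambda>s. F (u * G ^ s)"] cong)
      (simp_all add: cong_pow_p, simp add: cong_def)
  also have "\<dots> = of_Z4 R (- 1)"
  proof (rule sum_F_primroot[OF p odd_pq(1) _ _ Gp])
    show "F u [^] p = \<one>" using assms by (simp add: F_pow F_eq_1_iff mult.commute[of u] mult_dvd_mono)
    show "F u \<noteq> \<one>" using assms by (auto simp: F_eq_1_iff elim: dvd_mult_left)
  qed
  finally show ?thesis by (simp flip: R.of_Z4_mult)
qed

lemma class_sum_0:
  assumes "p * q dvd u"
  shows "class_sum u k = \<zero>"
proof -
  have "F (u * x) = \<one>" for x using assms by (simp add: F_eq_1_iff)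
  then have "class_sum u k = of_Z4 R (int e) \<otimes> (\<Oplus>i\<in>{..<1::nat}. \<one>)"
    using R.finsum_periods[of "\<lambda>_. \<one>" 1 e] by (simp add: class_sum_def)
  also have "\<dots> = of_Z4 R (int e)" by (simp add: lessThan_Suc)
  also have "\<dots> = of_Z4 R 0"
  proof (rule of_Z4_eqI)
    have "4 dvd e" using e_lcm four_dvd(1) dvd_trans by (metis dvd_lcm1)
    then show "[int e = 0] (mod 4)" by (auto simp: cong_0_iff)
  qed
  finally show ?thesis by (simp add: R.of_Z4_0)
qed

lemma class_sum_shift: "class_sum 1 k = (\<Oplus>s\<in>{..<e}. F (G ^ (s + a) * H ^ k))"
proof -
  have "(\<Oplus>s\<in>{..<e}. F (G ^ (s + a) * H ^ k)) = (\<Oplus>s\<in>{..<e}. F (G ^ s * H ^ k))"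
    by (intro R.finsum_periodic_shift F_cong cong_mult)
      (simp_all add: cong_pow_pq, simp add: cong_def)
  then show ?thesis by (simp add: class_sum_def)
qed

lemma class_sum_add_4: "class_sum 1 (k + 4) = class_sum 1 k"
proof -
  obtain t where t: "[H ^ 4 = G ^ t] (mod p * q)" using H_pow_4 ..
  have "F (G ^ s * H ^ (k + 4)) = F (G ^ (s + t) * H ^ k)" for s
  proof (rule F_cong)
    have "[G ^ s * H ^ k * H ^ 4 = G ^ s * H ^ k * G ^ t] (mod p * q)"
      by (intro cong_mult cong_refl t)
    then show "[G ^ s * H ^ (k + 4) = G ^ (s + t) * H ^ k] (mod p * q)"
      by (simp only: power_add ac_simps)
  qed
  then show ?thesis using class_sum_shift[of k t] by (simp add: class_sum_def)
qed

lemma class_sum_unit: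
  assumes "[u = G ^ s * H ^ i] (mod p * q)"
  shows "class_sum u k = class_sum 1 (i + k)"
proof -
  have "F (u * (G ^ t * H ^ k)) = F (G ^ (t + s) * H ^ (i + k))" for t
  proof (rule F_cong)
    have "[u * (G ^ t * H ^ k) = G ^ s * H ^ i * (G ^ t * H ^ k)] (mod p * q)"
      by (intro cong_mult cong_refl assms)
    then show "[u * (G ^ t * H ^ k) = G ^ (t + s) * H ^ (i + k)] (mod p * q)"
      by (simp only: power_add ac_simps)
  qed
  then show ?thesis using class_sum_shift[of "i + k" s] by (simp add: class_sum_def)
qed

lemma sum_F_class: 
  assumes "k < 4"
  shows "(\<Oplus>v\<in>(\<lambda>s. (G ^ s * H ^ k) mod (p * q)) ` {..<e}. F v) = class_sum 1 k"
proof -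
  have "inj_on (\<lambda>s. (G ^ s * H ^ k) mod (p * q)) {..<e}"
    by (rule inj_onI)
      (auto simp: class_eq_iff assms simp flip: cong_def dest: cong_less_modulus_unique_nat)
  then have "(\<Oplus>v\<in>(\<lambda>s. (G ^ s * H ^ k) mod (p * q)) ` {..<e}. F v) =
      (\<Oplus>s\<in>{..<e}. F ((G ^ s * H ^ k) mod (p * q)))"
    by (intro R.finsum_reindex) auto
  also have "\<dots> = class_sum 1 k"
    unfolding class_sum_def by (intro R.finsum_cong' F_cong) (auto simp: cong_def)
  finally show ?thesis .
qed

lemma sum_F_all: "(\<Oplus>v\<in>{..<p * q}. F v) = \<zero>"
proof -
  have "F 1 \<noteq> \<one>" using pos by (auto simp: F_eq_1_iff)
  then have "(\<Oplus>v\<in>{..<p * q}. F 1 [^] v) = \<zero>"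
    using odd_pq by (intro sum_powers_root_of_unity) (auto simp: F_pow F_eq_1_iff)
  then show ?thesis by (simp add: F_pow)
qed

text \<open>A Ramanujan sum with value 1, the Moebius function at pq. All residues together give 0,
  the residue 0 gives 1, and the nonzero multiples of \<open>p\<close> and those of \<open>q\<close>
  give -1 each.\<close>

lemma sum_F_units: "(\<Oplus>v\<in>{v. v < p * q \<and> coprime v (p * q)}. F v) = \<one>"
proof -
  let ?U = "{v. v < p * q \<and> coprime v (p * q)}"
  let ?P = "(\<lambda>k. p * k) ` {1..<q}" and ?Q = "(\<lambda>k. q * k) ` {1..<p}"
  have prm: "coprime v n \<longleftrightarrow> \<not> n dvd v" if "prime n" for v n :: nat
    using that by (metis coprime_commute prime_imp_coprime_nat coprime_absorb_left not_prime_unit)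
  have split: "{..<p * q} = insert 0 (?P \<union> (?Q \<union> ?U))"
  proof (intro equalityI subsetI)
    fix v assume v: "v \<in> {..<p * q}"
    consider "v = 0" | "p dvd v" "v \<noteq> 0" | "q dvd v" "v \<noteq> 0" | "\<not> p dvd v" "\<not> q dvd v" by blast
    then show "v \<in> insert 0 (?P \<union> (?Q \<union> ?U))"
      using v by cases (auto simp: prm p q elim!: dvdE)
  next
    fix v assume "v \<in> insert 0 (?P \<union> (?Q \<union> ?U))"
    then show "v \<in> {..<p * q}" using pos by (auto simp: mult.commute)
  qed
  have QU: "?Q \<inter> ?U = {}" and PU: "?P \<inter> ?U = {}" by (auto simp: prm p q)
  have PQ: "?P \<inter> ?Q = {}"
  proof (intro equalityI subsetI)
    fix v assume "v \<in> ?P \<inter> ?Q"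
    then have "v \<in> ?P" "q dvd v" by auto
    then obtain k where "k \<in> {1..<q}" "v = p * k" by blast
    with \<open>q dvd v\<close> have k: "v = p * k" "1 \<le> k" "k < q" "q dvd v" by auto
    then have "q dvd k" using coprime_pq by (metis coprime_commute coprime_dvd_mult_right_iff)
    with k show "v \<in> {}" by (auto dest: dvd_imp_le)
  qed simp
  have "(\<Oplus>v\<in>?P. F v) = (\<Oplus>k\<in>{1..<q}. F (p * k))"
    using pos by (intro R.finsum_reindex) (auto simp: inj_on_def)
  also have "\<dots> = of_Z4 R (- 1)"
    using pos by (intro sum_F_multiples q odd_pq) (auto simp: F_pow F_eq_1_iff)
  finally have sP: "(\<Oplus>v\<in>?P. F v) = of_Z4 R (- 1)" .
  have "(\<Oplus>v\<in>?Q. F v) = (\<Oplus>k\<in>{1..<p}. F (q * k))"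
    using pos by (intro R.finsum_reindex) (auto simp: inj_on_def)
  also have "\<dots> = of_Z4 R (- 1)"
    using pos by (intro sum_F_multiples p odd_pq) (auto simp: F_pow F_eq_1_iff mult.commute[of q])
  finally have sQ: "(\<Oplus>v\<in>?Q. F v) = of_Z4 R (- 1)" .
  define W where "W = (\<Oplus>v\<in>?U. F v)"
  have W: "W \<in> carrier R" by (auto simp: W_def)
  have "\<zero> = (\<Oplus>v\<in>insert 0 (?P \<union> (?Q \<union> ?U)). F v)"
    using sum_F_all split by simp
  also have "\<dots> = F 0 \<oplus> (\<Oplus>v\<in>?P \<union> (?Q \<union> ?U). F v)"
    using pos by (intro R.finsum_insert) auto
  also have "(\<Oplus>v\<in>?P \<union> (?Q \<union> ?U). F v) = (\<Oplus>v\<in>?P. F v) \<oplus> (\<Oplus>v\<in>?Q \<union> ?U. F v)"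
    using PQ PU by (intro R.finsum_Un_disjoint) auto
  also have "(\<Oplus>v\<in>?Q \<union> ?U. F v) = (\<Oplus>v\<in>?Q. F v) \<oplus> W"
    unfolding W_def using QU by (intro R.finsum_Un_disjoint) auto
  also have "F 0 = of_Z4 R 1" by (simp add: F_eq_1_iff R.of_Z4_1)
  finally have "\<zero> = of_Z4 R (1 + (- 1)) \<oplus> (of_Z4 R (- 1) \<oplus> W)"
    unfolding sP sQ R.of_Z4_add using W by (simp add: R.a_assoc)
  then have "of_Z4 R (- 1) \<oplus> W = of_Z4 R (- 1) \<oplus> of_Z4 R 1"
    using W R.of_Z4_add[of "- 1" 1] by (simp add: R.of_Z4_0)
  then show ?thesis using W by (simp add: W_def R.of_Z4_1)
qed

lemma sum_class_sum: "(\<Oplus>k\<in>{..<4}. class_sum 1 k) = \<one>"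
proof -
  let ?h = "\<lambda>(s, k). (G ^ s * H ^ k) mod (p * q)"
  have Fm: "F (x mod (p * q)) = F x" for x by (rule F_cong) (simp add: cong_def)
  have "(\<Oplus>k\<in>{..<4}. class_sum 1 k) = (\<Oplus>x\<in>{..<4} \<times> {..<e}. F (G ^ snd x * H ^ fst x))"
    unfolding class_sum_def by (subst R.finsum_cartesian) auto
  also have "\<dots> = (\<Oplus>x\<in>{..<4} \<times> {..<e}. F (?h (prod.swap x)))"
    by (intro R.finsum_cong') (auto simp: Fm)
  also have "\<dots> = (\<Oplus>x\<in>prod.swap ` ({..<4} \<times> {..<e}). F (?h x))"
    by (intro R.finsum_reindex[symmetric]) auto
  also have "prod.swap ` ({..<4} \<times> {..<e}) = {..<e} \<times> {..<4}"
    by (rule product_swap)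
  also have "(\<Oplus>x\<in>{..<e} \<times> {..<4}. F (?h x)) = (\<Oplus>v\<in>?h ` ({..<e} \<times> {..<4}). F v)"
    using bij_betw_imp_inj_on[OF bij_betw_units] by (intro R.finsum_reindex[symmetric]) auto
  finally show ?thesis
    by (simp only: bij_betw_imp_surj_on[OF bij_betw_units] sum_F_units)
qed

end

section \<open>The interpolation formula\<close>

lemma (in cring) finsum_diff_weights:
  assumes fin: "finite A" and x: "x \<in> A \<rightarrow> carrier R" and w: "w \<in> A \<rightarrow> carrier R"
    and r: "r \<in> carrier R"
  shows "(\<Oplus>j\<in>A. (r \<ominus> w j) \<otimes> x j) = r \<otimes> (\<Oplus>j\<in>A. x j) \<ominus> (\<Oplus>j\<in>A. w j \<otimes> x j)"
proof -
  have car: "x j \<in> carrier R" "w j \<in> carrier R" if "j \<in> A" for j using x w that by auto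
  let ?D = "\<Oplus>j\<in>A. (r \<ominus> w j) \<otimes> x j" and ?W = "\<Oplus>j\<in>A. w j \<otimes> x j"
  have D: "?D \<in> carrier R" and W: "?W \<in> carrier R" using car r by auto
  have "?D \<oplus> ?W = (\<Oplus>j\<in>A. (r \<ominus> w j) \<otimes> x j \<oplus> w j \<otimes> x j)"
    using car r by (intro finsum_addf[symmetric]) auto
  also have "\<dots> = (\<Oplus>j\<in>A. r \<otimes> x j)"
  proof (intro finsum_cong')
    fix j assume "j \<in> A"
    note c = car[OF this] r
    have "(r \<ominus> w j) \<otimes> x j \<oplus> w j \<otimes> x j = ((r \<ominus> w j) \<oplus> w j) \<otimes> x j"
      using c by (simp add: l_distr)
    also have "(r \<ominus> w j) \<oplus> w j = r" using c by (simp add: minus_eq a_assoc l_neg)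
    finally show "(r \<ominus> w j) \<otimes> x j \<oplus> w j \<otimes> x j = r \<otimes> x j" .
  qed (use car r in auto)
  also have "\<dots> = r \<otimes> (\<Oplus>j\<in>A. x j)"
    using fin r x by (rule finsum_rdistr[symmetric])
  finally have "?D \<oplus> ?W = r \<otimes> (\<Oplus>j\<in>A. x j)" .
  moreover have "?D = (?D \<oplus> ?W) \<ominus> ?W" using D W by (simp add: minus_eq a_assoc r_neg)
  ultimately show ?thesis by simp
qed

context galois_reduction
begin

text \<open>The four copies of b c cancel, and -(0 + 1 + 2 + 3) c = -6c is 2c modulo 4, whatever
  \<open>b\<close> is.\<close>

lemma weighted_sum_const:
  assumes b: "b \<in> carrier R"
  shows "(\<Oplus>j\<in>{..<4::nat}. (b \<ominus> of_Z4 R (int j)) \<otimes> of_Z4 R c) = of_Z4 R (2 * c)"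
proof -
  have set4: "{..<4::nat} = {0, 1, 2, 3}" by auto
  have "(\<Oplus>j\<in>{..<4::nat}. of_Z4 R c) = of_Z4 R (c + (c + (c + c)))"
    unfolding set4 R.of_Z4_add by simp
  also have "\<dots> = of_Z4 R 0" by (rule of_Z4_eqI) (simp add: cong_0_iff)
  finally have 1: "(\<Oplus>j\<in>{..<4::nat}. of_Z4 R c) = \<zero>" by (simp add: R.of_Z4_0)
  have 2: "(\<Oplus>j\<in>{..<4::nat}. of_Z4 R (int j) \<otimes> of_Z4 R c) = of_Z4 R (0 + (c + (2 * c + 3 * c)))"
    unfolding set4 R.of_Z4_add R.of_Z4_mult by (simp add: R.of_Z4_0 R.of_Z4_1)
  have "of_Z4 R (2 * c) \<oplus> of_Z4 R (0 + (c + (2 * c + 3 * c))) = of_Z4 R 0"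
    unfolding R.of_Z4_add[symmetric] by (rule of_Z4_eqI) (simp add: cong_0_iff)
  then have "\<ominus> of_Z4 R (0 + (c + (2 * c + 3 * c))) = of_Z4 R (2 * c)"
    by (intro R.minus_equality) (simp_all only: R.of_Z4_0 R.of_Z4_closed)
  then show ?thesis
    using b R.finsum_diff_weights[of "{..<4}" "\<lambda>_. of_Z4 R c" "\<lambda>j. of_Z4 R (int j)" b]
    by (simp add: 1 2 R.minus_eq[of "\<zero>"])
qed

text \<open>
  The weight \<open>b - j\<close> equals \<open>(b - (i + j)) + i\<close>, and the terms with weight
  \<open>b - (i + j)\<close> form a full period of a sequence whose sum vanishes.
\<close>

lemma weighted_sum_cyclic:
  assumes x: "x \<in> UNIV \<rightarrow> carrier R" and per: "\<And>j. x (j + 4) = x j"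
    and one: "(\<Oplus>j\<in>{..<4::nat}. x j) = \<one>"
    and b: "b = x 1 \<oplus> of_Z4 R 2 \<otimes> x 2 \<oplus> of_Z4 R 3 \<otimes> x 3"
  shows "(\<Oplus>j\<in>{..<4::nat}. (b \<ominus> of_Z4 R (int j)) \<otimes> x (i + j)) = of_Z4 R (int i)"
proof -
  have x': "x j \<in> carrier R" for j using x by auto
  then have rc: "b \<in> carrier R" by (simp add: b)
  define f where "f j = (b \<ominus> of_Z4 R (int j)) \<otimes> x j" for j
  have f: "f \<in> UNIV \<rightarrow> carrier R" using rc x' by (auto simp: f_def)
  have set4: "{..<4::nat} = {0, 1, 2, 3}" by auto
  have "(\<Oplus>j\<in>{..<4}. of_Z4 R (int j) \<otimes> x j) = b"
    unfolding set4 b using x' by (simp add: R.of_Z4_0 R.of_Z4_1 R.a_assoc)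
  \<comment> \<open>Because the \<open>x j\<close> sum to 1, the sum of the \<open>f j\<close> is b
    - b.\<close>
  then have "(\<Oplus>j\<in>{..<4}. f j) = \<zero>"
    using R.finsum_diff_weights[of "{..<4}" x "\<lambda>j. of_Z4 R (int j)" b] x' rc one
    by (simp add: f_def R.minus_eq[of b b] R.r_neg)
  moreover have "f (j + 4) = f j" for j
    unfolding f_def per using of_Z4_eqI[of "int (j + 4)" "int j"] by (simp add: cong_def)
  ultimately have zero: "(\<Oplus>j\<in>{..<4}. f (j + i)) = \<zero>"
    using R.finsum_periodic_shift[OF f] by simp
  have "(\<Oplus>j\<in>{..<4}. x (j + i)) = \<one>"
    using R.finsum_periodic_shift[OF x per] one by simp
  then have "of_Z4 R (int i) = (\<Oplus>j\<in>{..<4}. f (j + i)) \<oplus> of_Z4 R (int i) \<otimes> (\<Oplus>j\<in>{..<4}. x (j + i))"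
    by (simp add: zero)
  also have "of_Z4 R (int i) \<otimes> (\<Oplus>j\<in>{..<4}. x (j + i)) = (\<Oplus>j\<in>{..<4}. of_Z4 R (int i) \<otimes> x (j + i))"
    using x' by (intro R.finsum_rdistr) auto
  also have "(\<Oplus>j\<in>{..<4}. f (j + i)) \<oplus> \<dots> = (\<Oplus>j\<in>{..<4}. f (j + i) \<oplus> of_Z4 R (int i) \<otimes> x (j + i))"
    using f x' by (intro R.finsum_addf[symmetric]) auto
  also have "\<dots> = (\<Oplus>j\<in>{..<4}. (b \<ominus> of_Z4 R (int j)) \<otimes> x (i + j))"
  proof (intro R.finsum_cong')
    fix j
    have "b \<ominus> of_Z4 R (int (j + i)) \<oplus> of_Z4 R (int i) = b \<ominus> of_Z4 R (int j)"
    proof -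
      have "of_Z4 R (int (j + i)) = of_Z4 R (int j) \<oplus> of_Z4 R (int i)"
        by (simp add: R.of_Z4_add)
      then show ?thesis
        using rc by (simp add: R.minus_eq R.minus_add R.a_assoc R.l_neg)
    qed
    then show "f (j + i) \<oplus> of_Z4 R (int i) \<otimes> x (j + i) = (b \<ominus> of_Z4 R (int j)) \<otimes> x (i + j)"
      unfolding f_def using x' rc by (simp add: add.commute flip: R.l_distr)
  qed (use rc x' in auto)
  finally show ?thesis ..
qed

end

section \<open>Evaluation of the right-hand side and collapse of the traces\<close>

context cyclotomic_galois
begin

definition rho where "rho = class_sum 1 1 \<oplus> of_Z4 R 2 \<otimes> class_sum 1 2 \<oplus> of_Z4 R 3 \<otimes> class_sum 1 3"

text \<open>The common form of both right-hand sides once their sums of traces have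
  collapsed.\<close>

definition interp where "interp u = of_Z4 R 2 \<oplus> of_Z4 R 2 \<otimes> p_sum u
  \<oplus> (\<Oplus>j\<in>{..<4::nat}. (rho \<ominus> of_Z4 R (int j)) \<otimes> class_sum u j)"

lemma rho_closed [simp]: "rho \<in> carrier R"
  by (simp add: rho_def)

lemma interp_const:
  assumes "\<And>j. class_sum u j = of_Z4 R c" and "p_sum u = of_Z4 R t"
  shows "interp u = of_Z4 R (2 + 2 * t + 2 * c)"
  unfolding interp_def using assms weighted_sum_const[OF rho_closed, of c]
  by (simp add: R.of_Z4_add R.of_Z4_mult)

lemma interp_dvd:
  "q dvd u \<Longrightarrow> interp u = of_Z4 R 2"
  "p dvd u \<Longrightarrow> \<not> q dvd u \<Longrightarrow> interp u = of_Z4 R 0"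
proof -
  assume qu: "q dvd u"
  show "interp u = of_Z4 R 2"
  proof (cases "p dvd u")
    case True
    then have "p * q dvd u" using qu coprime_pq by (intro semiring_gcd_class.divides_mult)
    then show ?thesis using interp_const[of u 0 0] class_sum_0 p_sum_eq[of u] True by (simp add: R.of_Z4_0)
  next
    case False
    have "interp u = of_Z4 R (2 + 2 * (- 1) + 2 * (- int ((q - 1) div 4)))"
      using class_sum_Q[OF qu False] p_sum_eq[of u] False by (intro interp_const) simp_all
    also have "\<dots> = of_Z4 R 2"
    proof (rule of_Z4_eqI)
      \<comment> \<open>Here 2 - 2 - 2(2k + 1) = -4k - 2, which is 2 modulo 4.\<close>
      obtain k where "(q - 1) div 4 = 2 * k + 1" using odd_pq(4) by (elim oddE)
      then show "[2 + 2 * (- 1) + 2 * (- int ((q - 1) div 4)) = 2] (mod 4)"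
        by (simp add: cong_iff_dvd_diff)
    qed
    finally show ?thesis .
  qed
next
  assume pu: "p dvd u" and qu: "\<not> q dvd u"
  have "interp u = of_Z4 R (2 + 2 * 0 + 2 * (- int ((p - 1) div 4)))"
    using class_sum_P[OF pu qu] p_sum_eq[of u] pu by (intro interp_const) simp_all
  also have "\<dots> = of_Z4 R 0"
  proof (rule of_Z4_eqI)
    \<comment> \<open>Here 2 - 2(2k + 1) = -4k; an even (p - 1)/4 would give 2 instead of 0.\<close>
    obtain k where "(p - 1) div 4 = 2 * k + 1" using odd_pq(3) by (elim oddE)
    then show "[2 + 2 * 0 + 2 * (- int ((p - 1) div 4)) = 0] (mod 4)"
      by (simp add: cong_iff_dvd_diff)
  qed
  finally show "interp u = of_Z4 R 0" .
qed

lemma interp_unit: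
  assumes u: "[u = G ^ s * H ^ i] (mod p * q)" and i: "i < 4"
  shows "interp u = of_Z4 R (int i)"
proof -
  have p_sum: "p_sum u = of_Z4 R (- 1)" using class_not_dvd[OF u] by (simp add: p_sum_eq)
  have "(\<Oplus>j\<in>{..<4::nat}. (rho \<ominus> of_Z4 R (int j)) \<otimes> class_sum 1 (i + j)) = of_Z4 R (int i)"
    by (rule weighted_sum_cyclic[OF _ _ sum_class_sum]) (use class_sum_add_4 in \<open>auto simp: rho_def\<close>)
  then have "interp u = of_Z4 R 2 \<oplus> of_Z4 R 2 \<otimes> of_Z4 R (- 1) \<oplus> of_Z4 R (int i)"
    unfolding interp_def p_sum by (simp only: class_sum_unit[OF u])
  also have "of_Z4 R 2 \<oplus> of_Z4 R 2 \<otimes> of_Z4 R (- 1) = \<zero>"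
    by (simp only: R.of_Z4_add[symmetric] R.of_Z4_mult[symmetric]) (simp add: R.of_Z4_0)
  finally show ?thesis by simp
qed

text \<open>Used with s = 1 if 2 is a power of \<open>G\<close> and with s = 2 if 4 is. The
  assumption \<open>rs\<close> says that the conjugates in one trace run exactly once through the
  subgroup generated by 2^s, so the number of outer terms is the index of that subgroup.\<close>

lemma sum_gr_trace:
  assumes r: "r = ord (p * q) 2" and t: "[2 ^ s = G ^ t] (mod p * q)"
    and rs: "r div s = ord (p * q) (2 ^ s)"
  shows "(\<Oplus>i\<in>{..<e div (r div s)}. gr_trace R s r (F (u * G ^ i * H ^ j))) = class_sum u j"
proof -
  have "p * q dvd 2 ^ r - 1"
    \<comment> \<open>The choice of \<open>r\<close> as the order of 2 makes every power of beta a
      Teichmuller element.\<close>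
    using ord[of 2 "p * q"] by (simp add: r cong_altdef_nat)
  then have root: "F x [^] (2 ^ r - 1 :: nat) = \<one>" for x
    by (simp add: F_pow F_eq_1_iff)
  have "gr_trace R s r (F (u * G ^ i * H ^ j)) =
      (\<Oplus>k\<in>{..<r div s}. F (u * H ^ j * (G ^ i * (2 ^ s) ^ k)))" for i
  proof -
    have "F (u * G ^ i * H ^ j) [^] (2 ^ (s * k) :: nat) = F (u * H ^ j * (G ^ i * (2 ^ s) ^ k))" for k
      by (simp only: F_pow power_mult[symmetric] ac_simps)
    then show ?thesis by (simp only: gr_trace_root_of_unity[OF F_closed root])
  qed
  note trace = this
  have sum: "(\<Oplus>i\<in>{..<e div (r div s)}. gr_trace R s r (F (u * G ^ i * H ^ j))) =
     (\<Oplus>s\<in>{..<ord (p * q) G}. F (u * H ^ j * G ^ s))"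
  proof -
    have "F (u * H ^ j * x) = F (u * H ^ j * y)" if "[x = y] (mod p * q)" for x y
      by (intro F_cong cong_mult cong_refl that)
    with R.finsum_power_cosets[OF coprime_G(3) _ t, of "\<lambda>x. F (u * H ^ j * x)"] pos
    show ?thesis by (simp add: rs ord_pq trace del: One_nat_def)
  qed
  show ?thesis unfolding sum by (simp add: class_sum_def ord_pq ac_simps)
qed

text \<open>Exponents divisible by \<open>q\<close> matter only modulo \<open>p\<close>, and there 2
  is always a power of the primitive root \<open>G\<close>. Hence this sum is the same whichever
  class contains 2.\<close>

lemma sum_gr_trace_subring:
  assumes r': "r' = ord p 2" and S: "subring S R"
    and red: "galois_reduction (R\<lparr>carrier := S\<rparr>) K' \<theta>' r'"
  shows "(\<Oplus>i\<in>{..<(p - 1) div r'}. gr_trace (R\<lparr>carrier := S\<rparr>) 1 r' (F (u * G ^ i * q))) = p_sum u"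
proof -
  interpret S: galois_reduction "R\<lparr>carrier := S\<rparr>" K' \<theta>' r' by (rule red)
  have "p dvd 2 ^ r' - 1" using ord[of 2 p] by (simp add: r' cong_altdef_nat)
  then have root: "F (x * q) [^] (2 ^ r' - 1 :: nat) = \<one>" for x
    by (simp add: F_pow F_eq_1_iff mult.assoc mult.commute[of q] mult_dvd_mono)
  have FS: "F (x * q) \<in> S" for x
    by (rule galois_subring_contains_roots[OF galois_reduction_axioms S red F_closed root])
  have pow: "y [^]\<^bsub>R\<lparr>carrier := S\<rparr>\<^esub> (k::nat) = y [^] k" for y k
    using R.nat_pow_consistent[of y k S] by simp
  have "gr_trace (R\<lparr>carrier := S\<rparr>) 1 r' (F (u * G ^ i * q)) =
      (\<Oplus>k\<in>{..<r'}. F (u * q * (G ^ i * 2 ^ k)))" for i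
  proof -
    have "gr_trace (R\<lparr>carrier := S\<rparr>) 1 r' (F (u * G ^ i * q)) =
        (\<Oplus>\<^bsub>R\<lparr>carrier := S\<rparr>\<^esub>k\<in>{..<r'}. F (u * q * (G ^ i * 2 ^ k)))"
    proof -
      have "F (u * G ^ i * q) [^] (2 ^ (1 * k) :: nat) = F (u * q * (G ^ i * 2 ^ k))" for k
        by (simp only: F_pow mult_1 ac_simps)
      moreover have "F (u * G ^ i * q) \<in> carrier (R\<lparr>carrier := S\<rparr>)" using FS by simp
      moreover have "F (u * G ^ i * q) [^]\<^bsub>R\<lparr>carrier := S\<rparr>\<^esub> (2 ^ r' - 1 :: nat) = \<one>\<^bsub>R\<lparr>carrier := S\<rparr>\<^esub>"
        using root by (simp add: pow)
      ultimately show ?thesis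
        using S.gr_trace_root_of_unity[of "F (u * G ^ i * q)" 1] by (simp only: pow div_by_1)
    qed
    also have "\<dots> = (\<Oplus>k\<in>{..<r'}. F (u * q * (G ^ i * 2 ^ k)))"
    proof (intro R.finsum_subring S funcsetI)
      fix k
      show "F (u * q * (G ^ i * 2 ^ k)) \<in> S"
        using FS[of "u * (G ^ i * 2 ^ k)"] by (simp only: ac_simps)
    qed
    finally show ?thesis .
  qed
  moreover have "F (u * q * x) = F (u * q * y)" if "[x = y] (mod p)" for x y
  proof (rule F_cong)
    have "[u * (q * x) = u * (q * y)] (mod q * p)"
      by (intro cong_mult cong_refl cong_cmult_leftI that)
    then show "[u * q * x = u * q * y] (mod p * q)" by (simp only: ac_simps)
  qed
  moreover obtain t where "[2 = G ^ t] (mod p)"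
  proof -
    have "p \<noteq> 2" using odd_pq(1) by auto
    then have "p > 2" using pos(1) by linarith
    then have "2 mod p \<in> totatives p" using odd_pq(1) by (simp add: totatives_def)
    then show ?thesis
      using that bij_betw_imp_surj_on[OF residue_primroot_is_generator[OF pos(1) Gp]]
      by (auto simp: cong_def)
  qed
  ultimately have "(\<Oplus>i\<in>{..<(p - 1) div r'}. gr_trace (R\<lparr>carrier := S\<rparr>) 1 r' (F (u * G ^ i * q))) =
     (\<Oplus>s\<in>{..<ord p G}. F (u * q * G ^ s))"
    using R.finsum_power_cosets[OF coprime_G(1), of 2 t "\<lambda>x. F (u * q * x)"] pos
    by (simp add: r' ord_p)
  then show ?thesis by (simp add: p_sum_def ord_p ac_simps)
qed

text \<open>The integers g and h may be negative, and so may the exponents in the theorem; this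
  passes to natural exponents.\<close>

lemma int_pow_F: "\<beta> [^] (z::int) = F (nat (z mod int (p * q)))"
proof -
  let ?n = "int (p * q)"
  have n: "?n > 0" using pos by simp
  show ?thesis
  proof (cases "z < 0")
    case False
    then have "0 \<le> z" by simp
    from nat_mod_distrib[OF this of_nat_0_le_iff]
    have "nat (z mod ?n) = nat z mod nat ?n" .
    then have "[nat z = nat (z mod ?n)] (mod p * q)" by (simp only: nat_int cong_def mod_mod_trivial)
    from F_cong[OF this] have "F (nat z) = F (nat (z mod ?n))" .
    moreover have "\<beta> [^] z = F (nat z)" using False by (simp only: int_pow_def2 F_def if_False)
    ultimately show ?thesis by (rule trans[rotated])
  next
    case True
    have "z mod ?n \<ge> 0" using n by (rule pos_mod_sign)
    \<comment> \<open>For negative \<open>z\<close>, the natural exponents -z and z mod pq add up to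
      a multiple of pq, so the corresponding powers of beta are inverse to each other.\<close>
    then have "int (nat (- z) + nat (z mod ?n)) = z mod ?n - z" using True by linarith
    moreover have "?n dvd z mod ?n - z" by (simp only: mod_eq_dvd_iff[symmetric] mod_mod_trivial)
    ultimately have "?n dvd int (nat (- z) + nat (z mod ?n))" by (simp only:)
    then have "p * q dvd nat (- z) + nat (z mod ?n)" by (simp only: int_dvd_int_iff)
    then have "F (nat (- z)) \<otimes> F (nat (z mod ?n)) = \<one>"
      by (simp add: F_eq_1_iff flip: F_add)
    then have "inv (F (nat (- z))) = F (nat (z mod ?n))" by (intro R.comm_inv_char) auto
    moreover have "\<beta> [^] z = inv (F (nat (- z)))" using True by (simp only: int_pow_def2 F_def if_True)
    ultimately show ?thesis by (rule trans[rotated])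
  qed
qed

lemma int_pow_F_cong:
  assumes "[z = int x] (mod int (p * q))"
  shows "\<beta> [^] z = F x"
proof -
  have "nat (z mod int (p * q)) = x mod (p * q)"
    using assms unfolding cong_def by (simp only: zmod_int[symmetric] nat_int)
  then show ?thesis using int_pow_F F_cong[of "x mod (p * q)" x] by (simp add: cong_def)
qed

end

section \<open>Transfer from the integers g and h to natural representatives\<close>

lemma cyc_class_eq_image:
  fixes g h :: int and p q G H :: nat
  assumes g: "[g = int G] (mod int (p * q))" and h: "[h = int H] (mod int (p * q))"
  shows "cyc_class p q g h k = (\<lambda>s. (G ^ s * H ^ k) mod (p * q)) ` {..<(p - 1) * (q - 1) div 4}"
proof -
  have "nat ((g ^ s * h ^ k) mod int (p * q)) = (G ^ s * H ^ k) mod (p * q)" for s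
  proof -
    have "[g ^ s * h ^ k = int (G ^ s * H ^ k)] (mod int (p * q))"
      unfolding of_nat_mult of_nat_power by (intro cong_mult cong_pow g[unfolded of_nat_mult] h[unfolded of_nat_mult])
    then have "(g ^ s * h ^ k) mod int (p * q) = int ((G ^ s * H ^ k) mod (p * q))"
      unfolding cong_def zmod_int .
    then show ?thesis by (simp only: nat_int)
  qed
  then show ?thesis unfolding cyc_class_def by auto
qed

lemma (in cyclotomic_classes) quat_seq_eq:
  assumes C: "\<And>k. cyc_class p q g h k = (\<lambda>s. (G ^ s * H ^ k) mod (p * q)) ` {..<e}"
  shows "q dvd u \<Longrightarrow> quat_seq p q g h u = 2"
    and "p dvd u \<Longrightarrow> \<not> q dvd u \<Longrightarrow> quat_seq p q g h u = 0"
    and "i < 4 \<Longrightarrow> [u = G ^ s * H ^ i] (mod p * q) \<Longrightarrow> quat_seq p q g h u = int i"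
proof -
  define v where "v = u mod (p * q)"
  have vlt: "v < p * q" using pos by (simp add: v_def)
  have dv: "p dvd v \<longleftrightarrow> p dvd u" "q dvd v \<longleftrightarrow> q dvd u"
    by (simp_all add: v_def dvd_mod_iff)
  have Q: "v \<in> {k * q |k. k \<in> {1..p - 1}} \<union> {0} \<longleftrightarrow> q dvd u"
  proof
    assume "q dvd u"
    then obtain k where k: "v = k * q" using dv by (metis dvdE mult.commute)
    then have "k < p" using vlt pos by simp
    with k show "v \<in> {k * q |k. k \<in> {1..p - 1}} \<union> {0}" by (cases "k = 0") auto
  qed (use dv in auto)
  have P: "v \<in> {k * p |k. k \<in> {1..q - 1}}" if "p dvd u" "\<not> q dvd u"
  proof -
    obtain k where k: "v = k * p" using dv \<open>p dvd u\<close> by (metis dvdE mult.commute)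
    then have "k < q" using vlt pos by (simp add: mult.commute)
    moreover have "k \<noteq> 0" using k that(2) dv(2) by (metis dvd_0_right mult_zero_left)
    ultimately show ?thesis using k by auto
  qed
  have seq: "quat_seq p q g h u =
      (if v \<in> {k * q |k. k \<in> {1..p - 1}} \<union> {0} then 2 else if v \<in> {k * p |k. k \<in> {1..q - 1}} then 0
       else int (THE i. i < 4 \<and> v \<in> cyc_class p q g h i))"
    by (simp only: quat_seq_def Let_def v_def)
  show "quat_seq p q g h u = 2" if "q dvd u"
    unfolding seq using that Q by (simp only: if_True)
  show "quat_seq p q g h u = 0" if "p dvd u" "\<not> q dvd u"
    unfolding seq using that Q P[OF that] by (simp only: if_True if_False)
  show "quat_seq p q g h u = int i" if i: "i < 4" and u: "[u = G ^ s * H ^ i] (mod p * q)"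
  proof -
    note nd = class_not_dvd[OF u]
    have "v \<notin> {k * p |k. k \<in> {1..q - 1}}" using nd dv by auto
    moreover have "(THE i. i < 4 \<and> v \<in> cyc_class p q g h i) = i"
    proof (rule the_equality)
      \<comment> \<open>The classes list only exponents below \<open>e\<close>, so \<open>s\<close>
        has to be reduced first.\<close>
      have "[s = s mod e] (mod e)" by (simp add: cong_def)
      then have "[G ^ s * H ^ i = G ^ (s mod e) * H ^ i] (mod p * q)"
        using class_eq_iff[OF i i] by blast
      then have "v = (G ^ (s mod e) * H ^ i) mod (p * q)"
        using u unfolding v_def cong_def by (simp only:)
      then show "i < 4 \<and> v \<in> cyc_class p q g h i" using i pos unfolding C by auto
    next
      fix j assume j: "j < 4 \<and> v \<in> cyc_class p q g h j"
      then obtain t where "v = (G ^ t * H ^ j) mod (p * q)" unfolding C by auto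
      then have "[G ^ s * H ^ i = G ^ t * H ^ j] (mod p * q)"
        using u unfolding v_def cong_def by (simp only:)
      then show "j = i" using class_eq_iff i j by blast
    qed
    ultimately show ?thesis unfolding seq using Q nd by (simp only: if_False)
  qed
qed

theorem theorem5:
  fixes R :: "('a, 'm) ring_scheme" (structure)
    and S :: "'a set" and \<beta> \<rho> :: 'a
    and p q e l l\<^sub>p :: nat and g h :: int
  assumes "prime p" and "prime q" and "p \<noteq> q"
    and "gcd (p - 1) (q - 1) = 4"
    and "e = (p - 1) * (q - 1) div 4"
    and "primitive_root p g" and "primitive_root q g"
    and "[h = g] (mod int p)" and "[h = 1] (mod int q)"
    and "l = ord (p * q) 2" and "l\<^sub>p = ord p 2"
    and "galois_ring4 l R"
    and "subring S R" and "galois_ring4 l\<^sub>p (R\<lparr>carrier := S\<rparr>)"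
    and "unit_of_order R (p * q) \<beta>"
    and "\<rho> = eval_Z4 R (class_poly p q g h 1) \<beta>
               \<oplus> of_Z4 R 2 \<otimes> eval_Z4 R (class_poly p q g h 2) \<beta>
               \<oplus> of_Z4 R 3 \<otimes> eval_Z4 R (class_poly p q g h 3) \<beta>"
    and "[p = 5] (mod 8)" and "[q = 5] (mod 8)"
  shows "(2 \<in> cyc_class p q g h 0 \<longrightarrow>
      (\<forall>u::nat. of_Z4 R (quat_seq p q g h u) =
        of_Z4 R 2
        \<oplus> of_Z4 R 2 \<otimes>
            (\<Oplus>i\<in>{..<(p - 1) div l\<^sub>p}.
               gr_trace (R\<lparr>carrier := S\<rparr>) 1 l\<^sub>p (\<beta> [^] (int u * g ^ i * int q)))
        \<oplus> (\<Oplus>j\<in>{..3::nat}. (\<rho> \<ominus> of_Z4 R (int j)) \<otimes>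
            (\<Oplus>i\<in>{..<e div l}. gr_trace R 1 l (\<beta> [^] (int u * g ^ i * h ^ j))))))
    \<and> (2 \<in> cyc_class p q g h 2 \<longrightarrow>
      (\<forall>u::nat. of_Z4 R (quat_seq p q g h u) =
        of_Z4 R 2
        \<oplus> of_Z4 R 2 \<otimes>
            (\<Oplus>i\<in>{..<(p - 1) div l\<^sub>p}.
               gr_trace (R\<lparr>carrier := S\<rparr>) 1 l\<^sub>p (\<beta> [^] (int u * g ^ i * int q)))
        \<oplus> (\<Oplus>j\<in>{..3::nat}. (\<rho> \<ominus> of_Z4 R (int j)) \<otimes>
            (\<Oplus>i\<in>{..<2 * e div l}. gr_trace R 2 l (\<beta> [^] (int u * g ^ i * h ^ j))))))"
proof -
  note prm = assms(1,2)
  let ?n = "p * q"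
  have n: "?n > 0" using prm by (simp add: prime_gt_0_nat)
  define G where "G = nat (g mod int ?n)"
  define H where "H = nat (h mod int ?n)"
  have lift: "[z = int (nat (z mod int ?n))] (mod int ?n)" for z
    using n by (simp add: cong_def)
  have g: "[g = int G] (mod int ?n)" and h: "[h = int H] (mod int ?n)"
    unfolding G_def H_def by (rule lift)+
  have gp: "[g = int G] (mod int p)" "[h = int H] (mod int p)"
    and gq: "[g = int G] (mod int q)" "[h = int H] (mod int q)"
    using g h by (auto intro: cong_modulus_mult simp: mult.commute)
  have Hp: "[H = G] (mod p)"
    using gp assms(8) unfolding cong_int_iff[symmetric] by (metis cong_sym cong_trans)
  have Hq: "[H = 1] (mod q)"
    using gq assms(9) unfolding cong_int_iff[symmetric] by (metis cong_sym cong_trans of_nat_1)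
  have root: "residue_primroot m G" if "primitive_root m g" "[g = int G] (mod int m)" for m
  proof -
    have "nat (g mod int m) = G mod m"
      using that(2) unfolding cong_def zmod_int[symmetric] by simp
    with that(1) show ?thesis by (simp add: primitive_root_def)
  qed
  interpret cyclotomic_classes p q G H e
    using assms(1-5) root[OF assms(6) gp(1)] root[OF assms(7) gq(1)] Hp Hq by unfold_locales
  \<comment> \<open>Oddness makes 2 a unit modulo \<open>p\<close> and modulo pq, so that both
    orders, the degrees of the Galois rings, are positive.\<close>
  have "odd p" "odd q"
    using assms(17,18) cong_dvd_iff[of p 5 8] cong_dvd_modulus_nat[of _ 5 8 2]
    by (auto simp: cong_def odd_iff_mod_2_eq_one)
  then have "l > 0" "l\<^sub>p > 0" using assms(10,11) by simp_all
  obtain K :: "(nat \<Rightarrow> int) set ring" and \<theta> where red: "galois_reduction R K \<theta> l"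
    using galois_ring4_reduction[OF assms(12) \<open>l > 0\<close>] by blast
  obtain K' :: "(nat \<Rightarrow> int) set ring" and \<theta>' where redS: "galois_reduction (R\<lparr>carrier := S\<rparr>) K' \<theta>' l\<^sub>p"
    using galois_ring4_reduction[OF assms(14) \<open>l\<^sub>p > 0\<close>] by blast
  interpret galois_reduction R K \<theta> l by (rule red)
  interpret cyclotomic_galois p q G H e R K \<theta> l \<beta>
    using assms(15,17,18) R.unit_of_order_iff[OF n] by unfold_locales auto
  have C: "cyc_class p q g h k = (\<lambda>s. (G ^ s * H ^ k) mod ?n) ` {..<e}" for k
    using cyc_class_eq_image[OF g h] by (simp add: assms(5))
  have ev: "eval_Z4 R (class_poly p q g h k) \<beta> = class_sum 1 k" if "k < 4" for k
    using eval_class_poly[OF \<beta>(1)] sum_F_class[OF that] by (simp add: C F_def)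
  have rho_eq: "\<rho> = rho" unfolding assms(16) rho_def by (simp add: ev)
  have seq: "of_Z4 R (quat_seq p q g h u) = interp u" for u
  proof -
    consider "q dvd u" | "p dvd u" "\<not> q dvd u" | "coprime u ?n"
      using prm by (metis coprime_commute coprime_mult_right_iff prime_imp_coprime_nat)
    then show ?thesis
    proof cases
      case 3
      then obtain s i where "i < 4" "[u = G ^ s * H ^ i] (mod ?n)" using unit_classE by blast
      then show ?thesis using quat_seq_eq(3)[OF C] interp_unit by simp
    qed (use quat_seq_eq(1,2)[OF C] interp_dvd in simp_all)
  qed
  have pow1: "\<beta> [^] (int u * g ^ i * int q) = F (u * G ^ i * q)" for u i
  proof (rule int_pow_F_cong)
    have "[int u * g ^ i * int q = int u * int G ^ i * int q] (mod int ?n)"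
      by (intro cong_mult cong_refl cong_pow g)
    then show "[int u * g ^ i * int q = int (u * G ^ i * q)] (mod int ?n)"
      by (simp only: semiring_1_class.of_nat_mult semiring_1_class.of_nat_power)
  qed
  have pow2: "\<beta> [^] (int u * g ^ i * h ^ j) = F (u * G ^ i * H ^ j)" for u i j
  proof (rule int_pow_F_cong)
    have "[int u * g ^ i * h ^ j = int u * int G ^ i * int H ^ j] (mod int ?n)"
      by (intro cong_mult cong_refl cong_pow g h)
    then show "[int u * g ^ i * h ^ j = int (u * G ^ i * H ^ j)] (mod int ?n)"
      by (simp only: semiring_1_class.of_nat_mult semiring_1_class.of_nat_power)
  qed
  have trace_p: "(\<Oplus>i\<in>{..<(p - 1) div l\<^sub>p}.
      gr_trace (R\<lparr>carrier := S\<rparr>) 1 l\<^sub>p (\<beta> [^] (int u * g ^ i * int q))) = p_sum u" for u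
    unfolding pow1 by (rule sum_gr_trace_subring[OF assms(11,13) redS])
  have class_0: "(\<Oplus>i\<in>{..<e div l}. gr_trace R 1 l (\<beta> [^] (int u * g ^ i * h ^ j))) = class_sum u j"
    if "2 \<in> cyc_class p q g h 0" for u j
  proof -
    obtain t where "2 = (G ^ t * H ^ 0) mod ?n" using \<open>2 \<in> _\<close> unfolding C by auto
    then have "2 mod ?n = (G ^ t * H ^ 0) mod ?n" by (metis mod_mod_trivial)
    then have "[2 ^ 1 = G ^ t] (mod ?n)" by (simp add: cong_def)
    from sum_gr_trace[OF assms(10) this, of u j] show ?thesis
      unfolding pow2 by (simp add: assms(10))
  qed
  have class_2: "(\<Oplus>i\<in>{..<2 * e div l}. gr_trace R 2 l (\<beta> [^] (int u * g ^ i * h ^ j))) = class_sum u j"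
    if "2 \<in> cyc_class p q g h 2" for u j
  proof -
    obtain a where "2 = (G ^ a * H ^ 2) mod ?n" using \<open>2 \<in> _\<close> unfolding C by auto
    then have a: "[2 = G ^ a * H ^ 2] (mod ?n)" unfolding cong_def by (metis mod_mod_trivial)
    have "[2 ^ l = 1] (mod ?n)" unfolding assms(10) by (rule ord)
    then obtain m where m: "l = 2 * m" using even_ord_of_class_2[OF a] by (auto elim: evenE)
    obtain t where t: "[H ^ 4 = G ^ t] (mod ?n)" using H_pow_4 ..
    \<comment> \<open>Squaring moves from class 2 to class 4, that is, into the powers of
      \<open>G\<close>.\<close>
    have "[2 ^ 2 = (G ^ a * H ^ 2) ^ 2] (mod ?n)" by (intro cong_pow a)
    also have "(G ^ a * H ^ 2) ^ 2 = G ^ (a * 2) * H ^ 4"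
      by (simp add: power_mult_distrib flip: power_mult)
    also have "[G ^ (a * 2) * H ^ 4 = G ^ (a * 2) * G ^ t] (mod ?n)" by (intro cong_mult cong_refl t)
    finally have t2: "[2 ^ 2 = G ^ (a * 2 + t)] (mod ?n)" by (simp only: power_add)
    \<comment> \<open>Since l = 2m, a power 4^d is 1 exactly when 2m divides 2d; thus 4 has order
      \<open>m\<close>, and 2e / l = e / m is the index of its subgroup.\<close>
    have "ord ?n (2 ^ 2) dvd d \<longleftrightarrow> m dvd d" for d
    proof -
      have "ord ?n (2 ^ 2) dvd d \<longleftrightarrow> l dvd 2 * d"
        unfolding assms(10) by (simp only: ord_divides[symmetric] power_mult)
      then show ?thesis by (simp add: m)
    qed
    then have "ord ?n (2 ^ 2) = l div 2" unfolding m by (metis dvd_antisym dvd_refl nonzero_mult_div_cancel_left zero_neq_numeral)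
    from sum_gr_trace[OF assms(10) t2 this[symmetric], of u j] show ?thesis
      unfolding pow2 by (simp add: m)
  qed
  have "{..3::nat} = {..<4}" by auto
  then show ?thesis
    unfolding seq interp_def trace_p rho_eq by (intro conjI impI allI) (simp_all only: class_0 class_2)
qed

end
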